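(* Let $n\in\mathbb{N}$, and let $a,b,c,r,s$ be real numbers with $a<b$, $c>0$ and $r,s\ge0$. Let $\{\alpha_k\}_{k=0}^\infty$ be a sequence of real numbers. The following are equivalent: (i) $\displaystyle Q_n^\alpha(x):=\sum_{k=0}^{\lfloor n/2\rfloor}\left(\sum_{j=0}^k\frac{\alpha_j}{(k+j)!(k-j)!}\right)\frac{x^k}{(n-2k)!}\in\mathscr{P}_n^+$; (ii) $\displaystyle Y_n^\alpha(x):=\sum_{k=0}^n\left(\sum_{j=0}^k\alpha_j\binom{n}{k+j}\binom{n}{k-j}\right)x^k\in\mathscr{P}_n^+$; (iii) $\displaystyle U_\alpha^{(a,b,c)}(g):=\sum_{k=0}^\infty\left(\sum_{j\ge0}\alpha_j\frac{g^{(k+j)}(x)}{(k+j)!}\frac{g^{(k-j)}(x)}{(k-j)!}\right)c^k(x-a)^k(x-b)^k$ has zeros only in $[a,b]$ for all polynomials $g$ of degree at most $n$ whose zeros all lie in $[a,b]$; (iv) $U_\alpha^{(a,b,-c)}(g)$ has zeros only in $(-\infty,a]\cup[b,\infty)$ for all polynomials $g$ of degree at most $n$ whose zeros lie in $(-\infty,a]$; (v) $U_\alpha^{(a,b,-c)}(g)$ has zeros only in $(-\infty,a]\cup[b,\infty)$ for all polynomials $g$ of degree at most $n$ whose zeros lie in $[b,\infty)$; (vi) $\displaystyle E_\alpha^{(r,s)}(g):=\sum_{k=0}^\infty\left(\sum_{j\ge0}\alpha_j\frac{g^{(k+j)}(x)}{(k+j)!}\frac{g^{(k-j)}(x)}{(k-j)!}\right)(rx-s)^k$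 has only real zeros for all $g\in\mathscr{P}_n^+$. Moreover, if any of the conditions above holds and $r=0$, then $E_\alpha^{(0,s)}(g)$ is stable whenever $g$ is stable and of degree at most $n$.
   Context: $\mathscr{P}_n^+$ denotes the set of all real polynomials of degree at most $n$ all of whose zeros are real and non-positive; by convention $0\in\mathscr{P}_n^+$. A polynomial $f\in\mathbb{C}[x]$ is stable if either $f\equiv0$ or $f(z)=0$ implies $\Im z\le0$. Here $g^{(m)}$ is the $m$-th derivative of $g$, and terms with $g^{(m)}/m!$ for $m<0$ are interpreted as $0$ (so in the inner sums only $0\le j\le k$ contribute). $U_\alpha^{(a,b,-c)}$ denotes the operator $U_\alpha^{(a,b,c)}$ with $c$ replaced by $-c$.
   Formalization: The implication from (vi) to the other conditions is stated only when r and s are not both 0, since for r=s=0 condition (vi) always holds (E(g)=α_0 g^2) and the claim fails, e.g. n=2, α_0=1, α_1=-4; the zero polynomial counts as having zeros only in any given set. *)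

theory Defs
  imports Complex_Main "HOL-Computational_Algebra.Polynomial"
begin

text \<open>
  "All zeros of p lie in S", with the zero polynomial admitted by convention
  (the operators below may map a nonzero polynomial to zero).
\<close>
definition zeros_in :: "complex poly \<Rightarrow> complex set \<Rightarrow> bool" where
  "zeros_in p S \<longleftrightarrow> p = 0 \<or> (\<forall>z. poly p z = 0 \<longrightarrow> z \<in> S)"

abbreviation complexify :: "real poly \<Rightarrow> complex poly" where
  "complexify \<equiv> map_poly complex_of_real"

definition P_plus :: "nat \<Rightarrow> real poly set" where
  "P_plus n = {p. degree p \<le> n \<and> zeros_in (complexify p) (complex_of_real ` {..0})}"

definition stable :: "complex poly \<Rightarrow> bool" where
  "stable p \<longleftrightarrow> zeros_in p {z. Im z \<le> 0}"

definition divided_deriv :: "nat \<Rightarrow> complex poly \<Rightarrow> complex poly" where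
  "divided_deriv m g = smult (1 / fact m) ((pderiv ^^ m) g)"

text \<open>
  The terms with j > k are zero because they involve a derivative of negative order.
\<close>
definition inner_sum :: "(nat \<Rightarrow> real) \<Rightarrow> nat \<Rightarrow> complex poly \<Rightarrow> complex poly" where
  "inner_sum \<alpha> k g =
     (\<Sum>j\<le>k. smult (of_real (\<alpha> j)) (divided_deriv (k + j) g * divided_deriv (k - j) g))"

text \<open>
  In the two operators the sum over all k may stop at the degree of g, since every
  term of the inner sum contains a derivative of g of order at least k.
\<close>
definition U_op :: "(nat \<Rightarrow> real) \<Rightarrow> real \<Rightarrow> real \<Rightarrow> real \<Rightarrow> complex poly \<Rightarrow> complex poly" where
  "U_op \<alpha> a b c g =
     (\<Sum>k\<le>degree g. inner_sum \<alpha> k g *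
        smult (of_real (c ^ k)) ([:- of_real a, 1:] ^ k * [:- of_real b, 1:] ^ k))"

definition E_op :: "(nat \<Rightarrow> real) \<Rightarrow> real \<Rightarrow> real \<Rightarrow> complex poly \<Rightarrow> complex poly" where
  "E_op \<alpha> r s g = (\<Sum>k\<le>degree g. inner_sum \<alpha> k g * [:- of_real s, of_real r:] ^ k)"

definition Q_poly :: "(nat \<Rightarrow> real) \<Rightarrow> nat \<Rightarrow> real poly" where
  "Q_poly \<alpha> n =
     (\<Sum>k\<le>n div 2. monom ((\<Sum>j\<le>k. \<alpha> j / (fact (k + j) * fact (k - j))) / fact (n - 2 * k)) k)"

definition Y_poly :: "(nat \<Rightarrow> real) \<Rightarrow> nat \<Rightarrow> real poly" where
  "Y_poly \<alpha> n =
     (\<Sum>k\<le>n. monom (\<Sum>j\<le>k. \<alpha> j * real (n choose (k + j)) * real (n choose (k - j))) k)"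

end

theory Submission
  imports Defs "HOL-Computational_Algebra.Fundamental_Theorem_Algebra"
begin

text \<open>
  Put \<open>\<mu> i = (\<Sum>j\<le>i. \<alpha> j * (2 * i choose (i + j)))\<close>. If \<open>g\<close> has the roots \<open>\<rho> l\<close> and
  \<open>v l = x - \<rho> l\<close>, \<open>u\<^sup>2 = W x\<close>, then, up to the square of the leading coefficient, the operator with
  weight \<open>W\<close> takes at \<open>x\<close> the value of a linear functional, sending \<open>S ^ (2 * i)\<close> to \<open>\<mu> i\<close> and odd powers
  to \<open>0\<close>, at \<open>\<Prod>l. (v l)\<^sup>2 + u\<^sup>2 + u * v l * S\<close>. This is the polarisation of
  \<open>R z = (\<Sum>i. (n choose (2 * i)) * \<mu> i * z ^ (n - 2 * i)) = n! * z ^ n * Q (1 / z\<^sup>2)\<close>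
  at the points \<open>v l / u + u / v l\<close>. If \<open>Q\<close> has only nonpositive zeros, then \<open>R\<close> has only imaginary ones,
  and the Grace--Walsh--Szego theorem shows that the value is nonzero as soon as all \<open>v l / u\<close>
  lie in the open right half plane. For every \<open>x\<close> outside the claimed zero set, a suitable square root \<open>u\<close>
  of \<open>W x\<close> has this property. Conversely, on \<open>g = (X - t) ^ n\<close> the operator equals
  \<open>(x - t) ^ (2 * n) * Y (W x / (x - t)\<^sup>2)\<close>, so that a zero of \<open>Y\<close> off the nonpositive axis can be
  moved to a forbidden zero; and \<open>Y t = n! * (1 + t) ^ n * Q (t / (1 + t)\<^sup>2)\<close> connects \<open>Y\<close> with \<open>Q\<close>.
\<close>

subsection \<open>Polar derivatives and the right half plane\<close>

text \<open>The image of \<open>(z + T) ^ m\<close> under the linear functional that sends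
  \<open>T ^ k\<close> to \<open>c k\<close>. For fixed \<open>c\<close> these polynomials form an
  Appell sequence, so differentiation lowers \<open>m\<close> without changing
  \<open>c\<close>.\<close>

definition binom_poly :: "(nat \<Rightarrow> complex) \<Rightarrow> nat \<Rightarrow> complex poly" where
  "binom_poly c m = (\<Sum>k\<le>m. monom (of_nat (m choose k) * c k) (m - k))"

lemma poly_binom_poly:
  "poly (binom_poly c m) z = (\<Sum>k\<le>m. of_nat (m choose k) * c k * z ^ (m - k))"
  by (simp add: binom_poly_def poly_sum poly_monom)

lemma degree_binom_poly_le: "degree (binom_poly c m) \<le> m"
  unfolding binom_poly_def
  by (intro degree_sum_le) (auto intro: order_trans[OF degree_monom_le])

lemma coeff_binom_poly:
  assumes "k \<le> m"
  shows "coeff (binom_poly c m) (m - k) = of_nat (m choose k) * c k"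
proof -
  have "coeff (binom_poly c m) (m - k) = (\<Sum>i\<le>m. if i = k then of_nat (m choose i) * c i else 0)"
    unfolding binom_poly_def coeff_sum coeff_monom by (rule sum.cong) (use assms in auto)
  then show ?thesis using assms by simp
qed

lemma binom_poly_eq_0_iff: "binom_poly c m = 0 \<longleftrightarrow> (\<forall>k\<le>m. c k = 0)"
proof
  assume "binom_poly c m = 0"
  then show "\<forall>k\<le>m. c k = 0" using coeff_binom_poly[of _ m c] by fastforce
qed (simp add: binom_poly_def)

lemma pderiv_binom_poly:
  "pderiv (binom_poly c (Suc m)) = smult (of_nat (Suc m)) (binom_poly c m)"
proof -
  have "Suc m * (m choose k) = (Suc m choose k) * (Suc m - k)" if "k \<le> m" for k
    using Suc_times_binomial_eq[of m "m - k"] that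
    by (simp add: binomial_symmetric[of k m] binomial_symmetric[of k "Suc m"] Suc_diff_le)
  then have *: "(of_nat (Suc m - k) * (of_nat (Suc m choose k) * c k) :: complex)
      = of_nat (Suc m) * (of_nat (m choose k) * c k)" if "k \<le> m" for k
    using that by (metis (no_types, lifting) mult.assoc mult.commute of_nat_mult)
  have "pderiv (binom_poly c (Suc m)) =
      (\<Sum>k\<le>m. monom (of_nat (Suc m - k) * (of_nat (Suc m choose k) * c k)) (m - k))"
    unfolding binom_poly_def higher_pderiv_sum[of 1, simplified] pderiv_monom by (simp add: monom_0)
  also have "\<dots> = (\<Sum>k\<le>m. monom (of_nat (Suc m) * (of_nat (m choose k) * c k)) (m - k))"
    by (intro sum.cong refl arg_cong2[where f=monom] *) auto
  also have "\<dots> = smult (of_nat (Suc m)) (binom_poly c m)"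
    by (simp add: binom_poly_def poly_eq_iff coeff_sum sum_distrib_left if_distrib
      cong: if_cong)
  finally show ?thesis .
qed

text \<open>Pascal's rule: one factor of \<open>(z + T) ^ Suc m\<close> is split off, and its
  summand \<open>T\<close> shifts the sequence \<open>c\<close>.\<close>

lemma poly_binom_poly_Suc:
  "poly (binom_poly c (Suc m)) z =
     z * poly (binom_poly c m) z + poly (binom_poly (\<lambda>k. c (Suc k)) m) z"
proof -
  have "poly (binom_poly c (Suc m)) z
      = c 0 * z ^ Suc m + (\<Sum>k\<le>m. of_nat (m choose Suc k) * c (Suc k) * z ^ (m - k))
        + poly (binom_poly (\<lambda>k. c (Suc k)) m) z"
    unfolding poly_binom_poly sum.atMost_Suc_shift
    by (simp add: algebra_simps sum.distrib)
  moreover have "z * poly (binom_poly c m) z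
      = (\<Sum>k\<le>Suc m. of_nat (m choose k) * c k * z ^ (Suc m - k))"
    unfolding poly_binom_poly sum_distrib_left
    by (simp add: Suc_diff_le algebra_simps)
  ultimately show ?thesis unfolding sum.atMost_Suc_shift by simp
qed

text \<open>A factor \<open>a + b * T\<close> is inserted under the functional, written as
  \<open>a + b * ((z + T) - z)\<close>. For \<open>b \<noteq> 0\<close> the right side times
  \<open>Suc m\<close> is \<open>b\<close> times the polar derivative of
  \<open>binom_poly c (Suc m)\<close> with pole \<open>a / b\<close>.\<close>

lemma poly_binom_poly_step:
  "poly (binom_poly (\<lambda>k. a * c k + b * c (Suc k)) m) z =
     a * poly (binom_poly c m) z + b * (poly (binom_poly c (Suc m)) z - z * poly (binom_poly c m) z)"
  unfolding poly_binom_poly_Suc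
  by (simp add: poly_binom_poly algebra_simps sum.distrib sum_distrib_left)

section \<open>Logarithmic derivatives, Laguerre's theorem and Gauss-Lucas for the right half
  plane\<close>

lemma poly_pderiv_proots:
  fixes f :: "complex poly"
  assumes "poly f z \<noteq> 0"
  shows "poly (pderiv f) z = poly f z * (\<Sum>\<rho>\<in>#proots f. 1 / (z - \<rho>))"
proof -
  have *: "poly (pderiv (\<Prod>x\<in>#A. [:-x, 1:])) z =
      poly (\<Prod>x\<in>#A. [:-x, 1:]) z * (\<Sum>\<rho>\<in>#A. 1 / (z - \<rho>))" if "z \<notin># A" for A
    using that
  proof (induction A)
    case (add x A)
    define P where "P = (\<Prod>x\<in>#A. [:-x, 1:])"
    have "poly (pderiv (\<Prod>x\<in>#add_mset x A. [:-x, 1:])) z =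
        poly P z + (z - x) * poly (pderiv P) z"
      by (simp only: image_mset_add_mset prod_mset.add_mset pderiv_mult flip: P_def)
        (simp add: pderiv_pCons algebra_simps)
    moreover have "poly (\<Prod>x\<in>#add_mset x A. [:-x, 1:]) z = (z - x) * poly P z"
      by (simp add: P_def algebra_simps)
    moreover have "poly (pderiv P) z = poly P z * (\<Sum>\<rho>\<in>#A. 1 / (z - \<rho>))" "z - x \<noteq> 0"
      using add by (auto simp: P_def)
    ultimately show ?case
      by (simp only: image_mset_add_mset sum_mset.add_mset) (simp add: divide_simps algebra_simps)
  qed simp
  have "z \<notin># proots f" using assms by (cases "f = 0") auto
  from *[OF this] show ?thesis
    by (subst (1 2) complex_poly_decompose_multiset[of f, symmetric]) (simp add: pderiv_smult)
qed

lemma Re_sum_mset: "Re (\<Sum>x\<in>#A. f x) = (\<Sum>x\<in>#A. Re (f x))"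
  by (induction A) auto

lemma Re_inverse_pos: "Re z > 0 \<Longrightarrow> Re (1 / z) > 0"
  by (cases "z = 0") (auto simp: Re_divide intro!: divide_pos_pos add_pos_nonneg)

lemma sum_mset_nonneg_real: "(\<And>x. x \<in># A \<Longrightarrow> f x \<ge> (0::real)) \<Longrightarrow> (\<Sum>x\<in>#A. f x) \<ge> 0"
  by (induction A) auto

lemma sum_mset_pos: "(\<And>x. x \<in># A \<Longrightarrow> f x > (0::real)) \<Longrightarrow> A \<noteq> {#} \<Longrightarrow> (\<Sum>x\<in>#A. f x) > 0"
  by (induction A) (simp_all add: add_pos_nonneg sum_mset_nonneg_real less_imp_le)

text \<open>Unlike \<open>zeros_in\<close>, this excludes the zero polynomial, so nonvanishing has
  to be tracked separately below.\<close>

definition right_nonzero :: "complex poly \<Rightarrow> bool" where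
  "right_nonzero f \<longleftrightarrow> (\<forall>z. Re z > 0 \<longrightarrow> poly f z \<noteq> 0)"

lemma right_nonzero_root: "right_nonzero f \<Longrightarrow> poly f \<rho> = 0 \<Longrightarrow> Re \<rho> \<le> 0"
  by (force simp: right_nonzero_def)

text \<open>The numbers \<^term>\<open>(\<zeta> - \<rho>) / (z - \<rho>)\<close> with \<^term>\<open>Re \<rho> \<le> 0\<close> fill a disc
  that avoids the origin and has a positive multiple of \<^term>\<open>\<zeta> + cnj z\<close> as its centre.\<close>
lemma polar_factor_pos:
  assumes "Re z > 0" "Re \<zeta> > 0" "Re \<rho> \<le> 0"
  shows "Re ((cnj \<zeta> + z) * ((\<zeta> - \<rho>) / (z - \<rho>))) > 0"
proof -
  define x where "x = Im \<zeta> - Im \<rho>"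
  define y where "y = Im z - Im \<rho>"
  define e where "e = - Re \<rho>"
  have e: "e \<ge> 0" using assms by (simp add: e_def)
  \<comment> \<open>Multiplying by \<open>cnj (z - \<rho>)\<close> instead of dividing by
    \<open>z - \<rho>\<close> changes the value only by a positive factor and leaves a sum of
    nonnegative terms whose first one is positive.\<close>
  have "Re ((cnj \<zeta> + z) * ((\<zeta> - \<rho>) * cnj (z - \<rho>))) =
     (Re \<zeta> + Re z) * (Re \<zeta> + e) * (Re z + e) + y\<^sup>2 * Re \<zeta> + x\<^sup>2 * Re z + e * (x - y)\<^sup>2"
    by (simp add: x_def y_def e_def algebra_simps power2_eq_square)
  also have "\<dots> > 0"
    using assms e by (intro add_pos_nonneg mult_pos_pos mult_nonneg_nonneg) auto
  finally have *: "Re ((cnj \<zeta> + z) * ((\<zeta> - \<rho>) * cnj (z - \<rho>))) > 0" .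
  have ne: "z \<noteq> \<rho>" using assms by auto
  have "(cnj \<zeta> + z) * ((\<zeta> - \<rho>) / (z - \<rho>)) =
      (cnj \<zeta> + z) * ((\<zeta> - \<rho>) * cnj (z - \<rho>)) / of_real ((cmod (z - \<rho>))\<^sup>2)"
    by (subst complex_div_cnj) simp
  then show ?thesis using * ne by (simp only: Re_divide_of_real) (simp add: zero_less_divide_iff)
qed

text \<open>Laguerre's theorem. Divided by \<open>poly f z\<close>, the expression is the sum of
  \<open>(\<zeta> - \<rho>) / (z - \<rho>)\<close> over the roots, plus \<open>n - degree f\<close>
  ones for the roots missing at infinity. Multiplied by \<open>cnj \<zeta> + z\<close>, each of
  these \<open>n\<close> summands has positive real part.\<close>

lemma laguerre_right_half_plane:
  assumes f: "right_nonzero f" and deg: "degree f \<le> n" and n: "n > 0"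
    and z: "Re z > 0" and \<zeta>: "Re \<zeta> > 0"
  shows "of_nat n * poly f z + (\<zeta> - z) * poly (pderiv f) z \<noteq> 0"
proof
  assume eq: "of_nat n * poly f z + (\<zeta> - z) * poly (pderiv f) z = 0"
  have fz: "poly f z \<noteq> 0" using f z by (auto simp: right_nonzero_def)
  have roots: "Re \<rho> \<le> 0" if "\<rho> \<in># proots f" for \<rho>
    using that f fz by (cases "f = 0") (auto intro: right_nonzero_root)
  define H where "H = (\<Sum>\<rho>\<in>#proots f. 1 / (z - \<rho>))"
  have "poly f z * (of_nat n + (\<zeta> - z) * H) = 0"
    using eq unfolding poly_pderiv_proots[OF fz] H_def by (simp add: algebra_simps)
  then have 0: "of_nat n + (\<zeta> - z) * H = 0" using fz by simp
  have "of_nat (size A) + (\<zeta> - z) * (\<Sum>\<rho>\<in>#A. 1 / (z - \<rho>)) = (\<Sum>\<rho>\<in>#A. (\<zeta> - \<rho>) / (z - \<rho>))"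
    if "\<forall>\<rho>\<in>#A. Re \<rho> \<le> 0" for A
    using that
  proof (induction A)
    case (add \<rho> A)
    have "z - \<rho> \<noteq> 0" using add.prems z by auto
    then have "1 + (\<zeta> - z) * (1 / (z - \<rho>)) = (\<zeta> - \<rho>) / (z - \<rho>)" by (simp add: field_simps)
    with add.IH add.prems have "(1 + (\<zeta> - z) * (1 / (z - \<rho>))) +
        (of_nat (size A) + (\<zeta> - z) * (\<Sum>\<rho>\<in>#A. 1 / (z - \<rho>))) =
        (\<zeta> - \<rho>) / (z - \<rho>) + (\<Sum>\<rho>\<in>#A. (\<zeta> - \<rho>) / (z - \<rho>))"
      by (intro arg_cong2[where f="(+)"]) auto
    then show ?case by (simp add: distrib_left add.commute add.left_commute add.assoc)
  qed simp
  from this[of "proots f"] have "of_nat (degree f) + (\<zeta> - z) * H = (\<Sum>\<rho>\<in>#proots f. (\<zeta> - \<rho>) / (z - \<rho>))"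
    using roots by (simp add: H_def size_proots_complex)
  moreover have "of_nat n = of_nat (n - degree f) + (of_nat (degree f) :: complex)"
    using deg by (simp flip: of_nat_add)
  ultimately have "of_nat (n - degree f) + (\<Sum>\<rho>\<in>#proots f. (\<zeta> - \<rho>) / (z - \<rho>)) = 0"
    using 0 by (simp add: add.assoc)
  then have "Re ((cnj \<zeta> + z) * (of_nat (n - degree f) + (\<Sum>\<rho>\<in>#proots f. (\<zeta> - \<rho>) / (z - \<rho>)))) = 0"
    by simp
  then have "(Re \<zeta> + Re z) * real (n - degree f)
      + (\<Sum>\<rho>\<in>#proots f. Re ((cnj \<zeta> + z) * ((\<zeta> - \<rho>) / (z - \<rho>)))) = 0"
    by (simp only: distrib_left sum_mset_distrib_left plus_complex.sel Re_sum_mset)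
      (simp add: algebra_simps)
  moreover have "(Re \<zeta> + Re z) * real (n - degree f) \<ge> 0" using z \<zeta> by simp
  moreover have "(\<Sum>\<rho>\<in>#proots f. Re ((cnj \<zeta> + z) * ((\<zeta> - \<rho>) / (z - \<rho>)))) > 0" if "proots f \<noteq> {#}"
    using that by (intro sum_mset_pos polar_factor_pos z \<zeta> roots)
  moreover have "(Re \<zeta> + Re z) * real (n - degree f) > 0" if "proots f = {#}"
    using that z \<zeta> n size_proots_complex[of f] by simp
  ultimately show False by (cases "proots f = {#}") auto
qed

text \<open>Gauss-Lucas: every summand \<open>1 / (z - \<rho>)\<close> of the logarithmic derivative
  has positive real part.\<close>

lemma right_nonzero_pderiv:
  assumes f: "right_nonzero f" and d: "pderiv f \<noteq> 0"
  shows "right_nonzero (pderiv f)"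
  unfolding right_nonzero_def
proof (intro allI impI)
  fix z assume z: "Re z > 0"
  have fz: "poly f z \<noteq> 0" using f z by (auto simp: right_nonzero_def)
  have "degree f \<noteq> 0" using d by (simp add: pderiv_eq_0_iff)
  then have ne: "proots f \<noteq> {#}" using size_proots_complex[of f] by auto
  have "Re (1 / (z - \<rho>)) > 0" if "\<rho> \<in># proots f" for \<rho>
  proof (rule Re_inverse_pos)
    have "Re \<rho> \<le> 0"
      using that f fz by (cases "f = 0") (auto intro: right_nonzero_root)
    then show "Re (z - \<rho>) > 0" using z by simp
  qed
  then have "Re (\<Sum>\<rho>\<in>#proots f. 1 / (z - \<rho>)) > 0"
    unfolding Re_sum_mset using ne by (intro sum_mset_pos) auto
  then show "poly (pderiv f) z \<noteq> 0"
    using fz unfolding poly_pderiv_proots[OF fz] by auto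
qed

text \<open>Repeated differentiation descends from \<open>n\<close> to \<open>m\<close>. A nonzero
  \<open>c k\<close> with \<open>k \<le> m\<close> also occurs in all higher polynomials of the
  sequence, so no derivative on the way is zero.\<close>

lemma right_nonzero_binom_poly_lower:
  assumes "right_nonzero (binom_poly c n)" "m \<le> n" "binom_poly c m \<noteq> 0"
  shows "right_nonzero (binom_poly c m)"
proof -
  have "right_nonzero (binom_poly c k)" if "m \<le> k" "k \<le> n" for k
    using that(2,1)
  proof (induction k rule: inc_induct)
    case (step k)
    have "binom_poly c k \<noteq> 0"
      using step.hyps step.prems assms(3) unfolding binom_poly_eq_0_iff by (meson le_trans)
    then have "right_nonzero (pderiv (binom_poly c (Suc k)))"
      using step by (intro right_nonzero_pderiv) (auto simp del: of_nat_Suc simp: pderiv_binom_poly)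
    then show ?case by (auto simp del: of_nat_Suc simp: pderiv_binom_poly right_nonzero_def)
  qed (rule assms)
  then show ?thesis using assms(2) by blast
qed

text \<open>Laguerre's theorem with the pole \<open>\<zeta> = a / b\<close>.\<close>

lemma right_nonzero_binom_poly_step:
  assumes nz: "right_nonzero (binom_poly c (Suc m))" and b: "b \<noteq> 0" and ab: "Re (a / b) > 0"
  shows "right_nonzero (binom_poly (\<lambda>k. a * c k + b * c (Suc k)) m)"
  unfolding right_nonzero_def
proof (intro allI impI)
  fix z assume z: "Re z > 0"
  let ?R = "binom_poly c (Suc m)"
  have "of_nat (Suc m) * poly (binom_poly (\<lambda>k. a * c k + b * c (Suc k)) m) z =
      b * (of_nat (Suc m) * poly ?R z + (a / b - z) * poly (pderiv ?R) z)"
    using b unfolding poly_binom_poly_step pderiv_binom_poly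
    by (simp del: of_nat_Suc add: field_simps)
  also have "\<dots> \<noteq> 0"
    using laguerre_right_half_plane[OF nz degree_binom_poly_le _ z ab] b by simp
  finally show "poly (binom_poly (\<lambda>k. a * c k + b * c (Suc k)) m) z \<noteq> 0" by auto
qed

subsection \<open>The nonlinear operator as a polarised form\<close>

text \<open>\<open>U_op\<close> and \<open>E_op\<close> differ only in the weight \<open>W\<close>,
  and at a point \<open>x\<close> only the value of \<open>W\<close> matters.\<close>

definition gen_op :: "(nat \<Rightarrow> real) \<Rightarrow> complex poly \<Rightarrow> complex poly \<Rightarrow> complex poly" where
  "gen_op \<alpha> W g = (\<Sum>k\<le>degree g. inner_sum \<alpha> k g * W ^ k)"

text \<open>
  For \<open>p = (\<Prod>v\<in>#A. [:v, 1:])\<close> the product over \<open>A\<close> below is \<open>p (u T)\<close> times the reversal of it,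
  \<open>T ^ size A * p (u / T)\<close>, so its coefficient of \<open>T ^ (size A + 2 * j)\<close> collects all
  \<open>p (k + j) * p (k - j) * u ^ (2 * k)\<close>. The additional factor \<open>(1 + T\<^sup>2) ^ k\<close> is what makes the
  recursion on \<open>A\<close> close. The bound \<open>M\<close> only truncates vanishing terms, provided \<open>size A + k \<le> M\<close>.
\<close>
definition cross_form :: "(nat \<Rightarrow> real) \<Rightarrow> nat \<Rightarrow> complex \<Rightarrow> complex multiset \<Rightarrow> nat \<Rightarrow> complex" where
  "cross_form \<alpha> M u A k = (\<Sum>j\<le>M. of_real (\<alpha> j) *
     coeff ((\<Prod>v\<in>#A. [:u * v, v\<^sup>2 + u\<^sup>2, u * v:]) * [:1, 0, 1:] ^ k) (size A + k + 2 * j))"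

text \<open>The new factor is \<open>(v\<^sup>2 + u\<^sup>2) * T + u * v * (1 + T\<^sup>2)\<close>:
  its first part shifts the coefficient index by one, its second part raises the exponent
  \<open>k\<close>.\<close>

lemma cross_form_add_mset:
  "cross_form \<alpha> M u (add_mset v A) k = (v\<^sup>2 + u\<^sup>2) * cross_form \<alpha> M u A k + u * v * cross_form \<alpha> M u A (Suc k)"
proof -
  define P where "P = (\<Prod>v\<in>#A. [:u * v, v\<^sup>2 + u\<^sup>2, u * v:])"
  have eq: "[:u * v, v\<^sup>2 + u\<^sup>2, u * v:] * P * [:1, 0, 1:] ^ k =
      smult (u * v) (P * [:1, 0, 1:] ^ Suc k) + pCons 0 (smult (v\<^sup>2 + u\<^sup>2) (P * [:1, 0, 1:] ^ k))"
    by (simp add: algebra_simps smult_add_right)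
  have "cross_form \<alpha> M u (add_mset v A) k = (\<Sum>j\<le>M. of_real (\<alpha> j) *
     coeff ([:u * v, v\<^sup>2 + u\<^sup>2, u * v:] * P * [:1, 0, 1:] ^ k) (Suc (size A + k + 2 * j)))"
    by (simp add: cross_form_def P_def)
  also have "\<dots> = (v\<^sup>2 + u\<^sup>2) * cross_form \<alpha> M u A k + u * v * cross_form \<alpha> M u A (Suc k)"
    unfolding eq cross_form_def P_def[symmetric]
    by (simp add: sum_distrib_left algebra_simps flip: sum.distrib del: power_Suc)
  finally show ?thesis .
qed

lemma coeff_cross_power:
  "coeff ([:1, 0, 1 :: 'a :: comm_ring_1:] ^ k) m = (if even m then of_nat (k choose (m div 2)) else 0)"
proof -
  have "[:1, 0, 1 :: 'a:] = monom 1 2 + 1"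
    by (simp add: monom_altdef power2_eq_square one_pCons)
  then have "[:1, 0, 1 :: 'a:] ^ k = (\<Sum>i\<le>k. monom (of_nat (k choose i)) (2 * i))"
    by (simp add: binomial_ring monom_power of_nat_poly smult_monom)
  then have "coeff ([:1, 0, 1 :: 'a:] ^ k) m = (\<Sum>i\<le>k. if 2 * i = m then of_nat (k choose i) else 0)"
    by (simp add: coeff_sum)
  also have "\<dots> = (if even m then of_nat (k choose (m div 2)) else 0)"
  proof (cases "even m \<and> m div 2 \<le> k")
    case True
    then have "(\<Sum>i\<le>k. if 2 * i = m then of_nat (k choose i) else 0)
        = (\<Sum>i\<le>k. if i = m div 2 then of_nat (k choose i) else (0 :: 'a))"
      by (intro sum.cong) auto
    then show ?thesis using True by simp
  next
    case False
    then have "(\<Sum>i\<le>k. if 2 * i = m then of_nat (k choose i) else (0 :: 'a)) = 0"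
      by (intro sum.neutral) auto
    then show ?thesis using False by (auto simp: binomial_eq_0)
  qed
  finally show ?thesis .
qed

lemma cross_form_empty_odd: "odd k \<Longrightarrow> cross_form \<alpha> M u {#} k = 0"
  by (simp add: cross_form_def coeff_cross_power)

text \<open>These are the moments \<open>\<mu> i\<close> of the functional. The terms with
  \<open>j > i\<close> ask for more than \<open>2 * i\<close> elements and vanish;
  \<open>i \<le> M\<close> keeps all the others.\<close>

lemma cross_form_empty_even:
  assumes "i \<le> M"
  shows "cross_form \<alpha> M u {#} (2 * i) = (\<Sum>j\<le>i. of_real (\<alpha> j) * of_nat (2 * i choose (i + j)))"
proof -
  have "cross_form \<alpha> M u {#} (2 * i) = (\<Sum>j\<le>M. of_real (\<alpha> j) * of_nat (2 * i choose (i + j)))"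
    by (simp add: cross_form_def coeff_cross_power)
  also have "\<dots> = (\<Sum>j\<le>i. of_real (\<alpha> j) * of_nat (2 * i choose (i + j)))"
    using assms by (intro sum.mono_neutral_right) (auto simp: binomial_eq_0)
  finally show ?thesis .
qed

lemma poly_Q_poly:
  "poly (complexify (Q_poly \<alpha> n)) w = (\<Sum>k\<le>n div 2.
     of_real ((\<Sum>j\<le>k. \<alpha> j / (fact (k + j) * fact (k - j))) / fact (n - 2 * k)) * w ^ k)"
proof -
  have "complexify (Q_poly \<alpha> n) = (\<Sum>k\<le>n div 2.
     monom (of_real ((\<Sum>j\<le>k. \<alpha> j / (fact (k + j) * fact (k - j))) / fact (n - 2 * k))) k)"
    by (simp add: poly_eq_iff coeff_map_poly Q_poly_def coeff_sum if_distrib cong: if_cong)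
  then show ?thesis by (simp add: poly_sum poly_monom)
qed

lemma poly_Y_poly:
  "poly (complexify (Y_poly \<alpha> n)) w = (\<Sum>k\<le>n.
     of_real (\<Sum>j\<le>k. \<alpha> j * real (n choose (k + j)) * real (n choose (k - j))) * w ^ k)"
proof -
  have "complexify (Y_poly \<alpha> n) = (\<Sum>k\<le>n.
     monom (of_real (\<Sum>j\<le>k. \<alpha> j * real (n choose (k + j)) * real (n choose (k - j)))) k)"
    by (simp add: poly_eq_iff coeff_map_poly Y_poly_def coeff_sum if_distrib cong: if_cong)
  then show ?thesis by (simp add: poly_sum poly_monom)
qed

text \<open>Odd moments vanish, and the product of \<open>n choose (2 * i)\<close> and
  \<open>2 * i choose (i + j)\<close> is the multinomial coefficient
  \<open>fact n / (fact (n - 2 * i) * fact (i + j) * fact (i - j))\<close>.\<close>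

lemma binom_poly_cross_form_eq_Q_poly:
  assumes z: "z \<noteq> 0" and M: "n \<le> M"
  shows "poly (binom_poly (cross_form \<alpha> M u {#}) n) z =
    fact n * z ^ n * poly (complexify (Q_poly \<alpha> n)) (1 / z\<^sup>2)"
proof -
  let ?f = "\<lambda>k. of_nat (n choose k) * cross_form \<alpha> M u {#} k * z ^ (n - k)"
  have "poly (binom_poly (cross_form \<alpha> M u {#}) n) z = (\<Sum>k\<in>(\<lambda>i. 2 * i) ` {..n div 2}. ?f k)"
    unfolding poly_binom_poly
  proof (rule sum.mono_neutral_right)
    show "\<forall>k\<in>{..n} - (\<lambda>i. 2 * i) ` {..n div 2}. ?f k = 0"
    proof
      fix k assume k: "k \<in> {..n} - (\<lambda>i. 2 * i) ` {..n div 2}"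
      have "odd k"
      proof
        assume "even k"
        then obtain i where "k = 2 * i" by auto
        with k show False by auto
      qed
      then show "?f k = 0" by (simp add: cross_form_empty_odd)
    qed
  qed auto
  also have "\<dots> = (\<Sum>i\<le>n div 2. ?f (2 * i))"
    by (subst sum.reindex) (auto simp: inj_on_def)
  also have "\<dots> = (\<Sum>i\<le>n div 2. fact n * z ^ n *
     (of_real ((\<Sum>j\<le>i. \<alpha> j / (fact (i + j) * fact (i - j))) / fact (n - 2 * i)) * (1 / z\<^sup>2) ^ i))"
  proof (rule sum.cong[OF refl])
    fix i assume "i \<in> {..n div 2}"
    then have i: "2 * i \<le> n" by auto
    have "of_nat (n choose (2 * i)) * cross_form \<alpha> M u {#} (2 * i) =
        (\<Sum>j\<le>i. of_real (real (n choose (2 * i)) * (\<alpha> j * real (2 * i choose (i + j)))))"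
      using i M by (simp add: cross_form_empty_even sum_distrib_left)
    also have "\<dots> = (\<Sum>j\<le>i. of_real (fact n * (\<alpha> j / (fact (i + j) * fact (i - j)) / fact (n - 2 * i))))"
    proof (intro sum.cong refl arg_cong[where f=of_real])
      fix j assume "j \<in> {..i}"
      then have "i + j \<le> 2 * i" "2 * i - (i + j) = i - j" by auto
      then show "real (n choose (2 * i)) * (\<alpha> j * real (2 * i choose (i + j))) =
          fact n * (\<alpha> j / (fact (i + j) * fact (i - j)) / fact (n - 2 * i))"
        using i by (simp add: binomial_fact field_simps)
    qed
    also have "\<dots> = fact n * of_real ((\<Sum>j\<le>i. \<alpha> j / (fact (i + j) * fact (i - j))) / fact (n - 2 * i))"
      by (simp add: sum_distrib_left sum_divide_distrib)
    finally have 1: "of_nat (n choose (2 * i)) * cross_form \<alpha> M u {#} (2 * i) = \<dots>" .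
    have 2: "z ^ (n - 2 * i) = z ^ n * (1 / z\<^sup>2) ^ i"
      using i z by (simp add: power_diff power_mult power_divide)
    show "?f (2 * i) = fact n * z ^ n *
     (of_real ((\<Sum>j\<le>i. \<alpha> j / (fact (i + j) * fact (i - j))) / fact (n - 2 * i)) * (1 / z\<^sup>2) ^ i)"
      unfolding 1 2 by (simp only: mult_ac)
  qed
  finally show ?thesis by (simp add: poly_Q_poly sum_distrib_left)
qed

section \<open>The value of the operator at a point as a cross form\<close>

lemma coeff_prod_mset_scale:
  "coeff (\<Prod>v\<in>#A. [:v, u:]) i = u ^ i * coeff (\<Prod>v\<in>#A. [:v, 1 :: complex:]) i"
proof (induction A arbitrary: i)
  case empty
  show ?case by (cases i) auto
next
  case (add v A)
  show ?case by (cases i) (simp_all add: add algebra_simps)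
qed

lemma degree_prod_mset_linear_le: "degree (\<Prod>v\<in>#A. [:f v, g v :: complex:]) \<le> size A"
proof (induction A)
  case (add v A)
  have "degree ([:f v, g v:] * (\<Prod>v\<in>#A. [:f v, g v:])) \<le> 1 + degree (\<Prod>v\<in>#A. [:f v, g v:])"
    by (rule order_trans[OF degree_mult_le]) simp
  with add show ?case by simp
qed simp

text \<open>With \<open>p = (\<Prod>v\<in>#A. [:v, 1:])\<close> the product on the left is
  \<open>T ^ size A * p (u / T)\<close>. Counting from \<open>size A\<close> instead of the degree
  admits factors with \<open>v = 0\<close>.\<close>

lemma coeff_prod_mset_reflect:
  assumes "b \<le> size A"
  shows "coeff (\<Prod>v\<in>#A. [:u, v:]) (size A - b) = u ^ b * coeff (\<Prod>v\<in>#A. [:v, 1 :: complex:]) b"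
  using assms
proof (induction A arbitrary: b)
  case (add v A)
  have top: "coeff (\<Prod>v\<in>#A. [:u, v:]) i = 0" if "i > size A" for i
    using that degree_prod_mset_linear_le[of "\<lambda>_. u" "\<lambda>v. v" A] by (intro coeff_eq_0) simp
  have top': "coeff (\<Prod>v\<in>#A. [:v, 1:]) i = 0" if "i > size A" for i :: nat
    using that degree_prod_mset_linear_le[of "\<lambda>v. v" "\<lambda>_. 1" A] by (intro coeff_eq_0) simp
  show ?case
  proof (cases b)
    case 0
    then show ?thesis using add.IH[of 0] top[of "Suc (size A)"] by simp
  next
    case (Suc b')
    show ?thesis
    proof (cases "b' < size A")
      case True
      then have "size A - b' = Suc (size A - Suc b')" by simp
      then show ?thesis using add.IH[of b'] add.IH[of b] True Suc
        by (simp add: algebra_simps)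
    next
      case False
      then have "b' = size A" using add.prems Suc by simp
      then show ?thesis using add.IH[of b'] Suc top' by (simp add: algebra_simps)
    qed
  qed
qed auto

text \<open>Each quadratic factor splits as \<open>(v + u * T) * (u + v * T)\<close>. In the
  resulting product \<open>P * R\<close>, the coefficient of \<open>T ^ (size A + 2 * j)\<close>
  pairs the coefficient \<open>k + j\<close> of \<open>P\<close> with the coefficient
  \<open>size A - (k - j)\<close> of \<open>R\<close>.\<close>

lemma op_value_eq_cross_form:
  fixes A :: "complex multiset"
  assumes M: "size A \<le> M"
  defines "p \<equiv> coeff (\<Prod>v\<in>#A. [:v, 1:])"
  shows "(\<Sum>k\<le>size A. \<Sum>j\<le>k. of_real (\<alpha> j) * (p (k + j) * p (k - j)) * (u\<^sup>2) ^ k) = cross_form \<alpha> M u A 0"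
proof -
  let ?d = "size A"
  define P where "P = (\<Prod>v\<in>#A. [:v, u:])"
  define R where "R = (\<Prod>v\<in>#A. [:u, v:])"
  have PR: "(\<Prod>v\<in>#A. [:u * v, v\<^sup>2 + u\<^sup>2, u * v:]) = P * R"
  proof -
    have "P * R = (\<Prod>v\<in>#A. [:v, u:] * [:u, v:])" by (simp only: P_def R_def prod_mset.distrib)
    also have "(\<lambda>v. [:v, u:] * [:u, v:]) = (\<lambda>v. [:u * v, v\<^sup>2 + u\<^sup>2, u * v:])"
      by (simp add: fun_eq_iff power2_eq_square algebra_simps)
    finally show ?thesis by simp
  qed
  have p0: "p i = 0" if "i > ?d" for i
    using that degree_prod_mset_linear_le[of "\<lambda>v. v" "\<lambda>_. 1" A] unfolding p_def
    by (intro coeff_eq_0) simp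
  have R0: "coeff R i = 0" if "i > ?d" for i
    using that degree_prod_mset_linear_le[of "\<lambda>_. u" "\<lambda>v. v" A] unfolding R_def
    by (intro coeff_eq_0) simp
  have Pi: "coeff P i = u ^ i * p i" for i unfolding P_def p_def by (rule coeff_prod_mset_scale)
  have Ri: "coeff R (?d - b) = u ^ b * p b" if "b \<le> ?d" for b
    unfolding R_def p_def using that by (rule coeff_prod_mset_reflect)
  have *: "coeff (P * R) (?d + 2 * j) = (\<Sum>k\<in>{j..?d}. p (k + j) * p (k - j) * (u\<^sup>2) ^ k)" for j
  proof -
    have "coeff (P * R) (?d + 2 * j) = (\<Sum>i\<le>?d + 2 * j. coeff P i * coeff R (?d + 2 * j - i))"
      by (rule coeff_mult)
    also have "\<dots> = (\<Sum>i\<in>(\<lambda>k. k + j) ` {j..?d}. coeff P i * coeff R (?d + 2 * j - i))"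
    proof (rule sum.mono_neutral_right)
      show "\<forall>i\<in>{..?d + 2 * j} - (\<lambda>k. k + j) ` {j..?d}. coeff P i * coeff R (?d + 2 * j - i) = 0"
      proof
        fix i assume i: "i \<in> {..?d + 2 * j} - (\<lambda>k. k + j) ` {j..?d}"
        \<comment> \<open>In the first case the index into \<open>R\<close> exceeds the degree bound
          \<open>?d\<close>, in the second the index into \<open>P\<close> does.\<close>
        have "i < 2 * j \<or> i > ?d"
        proof (rule ccontr)
          assume "\<not> ?thesis"
          then have "i = (i - j) + j" "i - j \<in> {j..?d}" by auto
          with i show False by blast
        qed
        then show "coeff P i * coeff R (?d + 2 * j - i) = 0" by (auto simp: Pi p0 R0)
      qed
    qed auto
    also have "\<dots> = (\<Sum>k\<in>{j..?d}. coeff P (k + j) * coeff R (?d + 2 * j - (k + j)))"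
      by (subst sum.reindex) auto
    also have "\<dots> = (\<Sum>k\<in>{j..?d}. p (k + j) * p (k - j) * (u\<^sup>2) ^ k)"
    proof (rule sum.cong[OF refl])
      fix k assume k: "k \<in> {j..?d}"
      then have idx: "?d + 2 * j - (k + j) = ?d - (k - j)" and le: "k - j \<le> ?d" by auto
      have "coeff P (k + j) * coeff R (?d + 2 * j - (k + j)) =
          p (k + j) * p (k - j) * (u ^ (k + j) * u ^ (k - j))"
        unfolding idx Pi Ri[OF le] by (simp only: mult_ac)
      also have "u ^ (k + j) * u ^ (k - j) = (u\<^sup>2) ^ k"
        using k by (simp add: mult_2 flip: power_mult power_add)
      finally show "coeff P (k + j) * coeff R (?d + 2 * j - (k + j)) = p (k + j) * p (k - j) * (u\<^sup>2) ^ k" .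
    qed
    finally show ?thesis .
  qed
  have "cross_form \<alpha> M u A 0 = (\<Sum>j\<le>M. \<Sum>k\<in>{j..?d}. of_real (\<alpha> j) * (p (k + j) * p (k - j)) * (u\<^sup>2) ^ k)"
    unfolding cross_form_def PR by (simp add: * sum_distrib_left mult.assoc)
  also have "\<dots> = (\<Sum>j\<le>M. \<Sum>k\<in>{k. k \<in> {..?d} \<and> j \<le> k}. of_real (\<alpha> j) * (p (k + j) * p (k - j)) * (u\<^sup>2) ^ k)"
    by (intro sum.cong) auto
  also have "\<dots> = (\<Sum>k\<le>?d. \<Sum>j\<in>{j. j \<in> {..M} \<and> j \<le> k}. of_real (\<alpha> j) * (p (k + j) * p (k - j)) * (u\<^sup>2) ^ k)"
    by (rule sum.swap_restrict) auto
  also have "\<dots> = (\<Sum>k\<le>?d. \<Sum>j\<le>k. of_real (\<alpha> j) * (p (k + j) * p (k - j)) * (u\<^sup>2) ^ k)"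
    using M by (intro sum.cong) auto
  finally show ?thesis by simp
qed

text \<open>Taylor coefficients at \<open>x\<close>: translation commutes with
  differentiation.\<close>

lemma poly_divided_deriv: "poly (divided_deriv m g) x = coeff (g \<circ>\<^sub>p [:x, 1:]) m"
proof -
  have shift: "(pderiv ^^ m) (g \<circ>\<^sub>p [:x, 1:]) = (pderiv ^^ m) g \<circ>\<^sub>p [:x, 1:]"
    by (induction m) (simp_all add: pderiv_pcompose pderiv_pCons)
  have "fact m * coeff (g \<circ>\<^sub>p [:x, 1:]) m = coeff ((pderiv ^^ m) (g \<circ>\<^sub>p [:x, 1:])) 0"
    by (simp add: coeff_higher_pderiv pochhammer_fact)
  also have "\<dots> = poly ((pderiv ^^ m) g) x"
    unfolding shift by (simp flip: poly_0_coeff_0 add: poly_pcompose)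
  finally show ?thesis by (simp add: divided_deriv_def field_simps)
qed

lemma poly_divided_deriv_proots:
  "poly (divided_deriv m g) x = lead_coeff g * coeff (\<Prod>v\<in>#image_mset (\<lambda>\<rho>. x - \<rho>) (proots g). [:v, 1:]) m"
proof -
  have *: "(\<Prod>\<rho>\<in>#B. [:-\<rho>, 1:]) \<circ>\<^sub>p [:x, 1:] = (\<Prod>v\<in>#image_mset (\<lambda>\<rho>. x - \<rho>) B. [:v, 1:])" for B
  proof (induction B)
    case (add \<rho> B)
    then show ?case
      by (simp only: image_mset_add_mset prod_mset.add_mset pcompose_mult) (simp add: pcompose_pCons)
  qed (simp add: pcompose_1)
  have "g \<circ>\<^sub>p [:x, 1:] = smult (lead_coeff g) (\<Prod>\<rho>\<in>#proots g. [:-\<rho>, 1:]) \<circ>\<^sub>p [:x, 1:]"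
    by (simp only: complex_poly_decompose_multiset)
  also have "\<dots> = smult (lead_coeff g) (\<Prod>v\<in>#image_mset (\<lambda>\<rho>. x - \<rho>) (proots g). [:v, 1:])"
    by (simp only: pcompose_smult *)
  finally show ?thesis unfolding poly_divided_deriv by simp
qed

text \<open>The Taylor coefficients of \<open>g\<close> at \<open>x\<close> come from the linear
  factors with \<open>v = x - \<rho>\<close>. Either square root \<open>u\<close> of the weight is
  allowed; the choice is made later to suit the roots.\<close>

lemma poly_gen_op:
  assumes "degree g \<le> M" "poly W x = u\<^sup>2"
  shows "poly (gen_op \<alpha> W g) x =
    (lead_coeff g)\<^sup>2 * cross_form \<alpha> M u (image_mset (\<lambda>\<rho>. x - \<rho>) (proots g)) 0"
proof -
  let ?A = "image_mset (\<lambda>\<rho>. x - \<rho>) (proots g)"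
  have s: "size ?A = degree g" by (simp add: size_proots_complex)
  have "poly (gen_op \<alpha> W g) x = (lead_coeff g)\<^sup>2 *
      (\<Sum>k\<le>size ?A. \<Sum>j\<le>k. of_real (\<alpha> j) *
        (coeff (\<Prod>v\<in>#?A. [:v, 1:]) (k + j) * coeff (\<Prod>v\<in>#?A. [:v, 1:]) (k - j)) * (u\<^sup>2) ^ k)"
    unfolding s gen_op_def inner_sum_def poly_sum poly_mult poly_power assms(2) poly_smult
      poly_divided_deriv_proots sum_distrib_left sum_distrib_right
    by (simp add: power2_eq_square mult_ac del: power_mult_distrib)
  also have "\<dots> = (lead_coeff g)\<^sup>2 * cross_form \<alpha> M u ?A 0"
    using assms s by (subst op_value_eq_cross_form[where M=M]) auto
  finally show ?thesis .
qed

section \<open>Grace-Walsh-Szego and nonvanishing of the operator\<close>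

text \<open>Unfolding the recursion over \<open>A\<close> reaches only the moments up to
  \<open>m + size A\<close>.\<close>

lemma cross_form_eq_0:
  assumes "\<And>k. k \<le> m + size A \<Longrightarrow> cross_form \<alpha> M u {#} k = 0" "k \<le> m"
  shows "cross_form \<alpha> M u A k = 0"
  using assms
proof (induction A arbitrary: m k)
  case (add v A)
  have "cross_form \<alpha> M u A i = 0" if "i \<le> Suc m" for i
    using add.IH[of "Suc m"] add.prems(1) that by simp
  with add.prems(2) show ?case by (simp add: cross_form_add_mset)
qed auto

text \<open>Grace--Walsh--Szego: each \<^term>\<open>v\<close> contributes one polar derivative with pole
  \<^term>\<open>v / u + u / v\<close>.\<close>
lemma right_nonzero_cross_form:
  assumes "right_nonzero (binom_poly (cross_form \<alpha> M u {#}) (m + size A))" "u \<noteq> 0"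
    and "\<And>v. v \<in># A \<Longrightarrow> Re (v / u) > 0"
  shows "right_nonzero (binom_poly (cross_form \<alpha> M u A) m)"
  using assms(1,3)
proof (induction A arbitrary: m)
  case (add v A)
  have IH: "right_nonzero (binom_poly (cross_form \<alpha> M u A) (Suc m))"
    using add by simp
  have vu: "Re (v / u) > 0" using add.prems by simp
  then have v: "v \<noteq> 0" by auto
  have "(v\<^sup>2 + u\<^sup>2) / (u * v) = v / u + 1 / (v / u)"
    using v \<open>u \<noteq> 0\<close> by (simp add: field_simps power2_eq_square)
  moreover have "Re (1 / (v / u)) > 0"
    using vu by (rule Re_inverse_pos)
  ultimately have "Re ((v\<^sup>2 + u\<^sup>2) / (u * v)) > 0" using vu by simp
  then have "right_nonzero (binom_poly
      (\<lambda>k. (v\<^sup>2 + u\<^sup>2) * cross_form \<alpha> M u A k + u * v * cross_form \<alpha> M u A (Suc k)) m)"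
    using v \<open>u \<noteq> 0\<close> by (intro right_nonzero_binom_poly_step[OF IH]) auto
  then show ?case by (simp only: cross_form_add_mset)
qed auto

text \<open>Without factors \<open>u\<close> does not occur, so the moments are the same at every
  point \<open>x\<close>.\<close>

lemma cross_form_empty_indep: "cross_form \<alpha> M u {#} = cross_form \<alpha> M u' {#}"
  by (simp add: cross_form_def fun_eq_iff)

lemma zeros_in_P_plus:
  assumes "Q \<in> P_plus n" "Q \<noteq> 0" "poly (complexify Q) w = 0"
  shows "\<exists>t\<le>0. w = of_real t"
  using assms by (auto simp: P_plus_def zeros_in_def map_poly_eq_0_iff)

text \<open>Since the operator does not give the zero polynomial, some moment of index at most
  \<open>degree g\<close> is nonzero. This lets the half plane property descend from
  \<open>n\<close> to \<open>degree g\<close>; then each root of \<open>g\<close> uses up one polar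
  derivative.\<close>

theorem poly_gen_op_nonzero:
  assumes Q: "Q_poly \<alpha> n \<in> P_plus n" and g: "degree g \<le> n" and nz: "gen_op \<alpha> W g \<noteq> 0"
    and W: "poly W x = u\<^sup>2" and u: "u \<noteq> 0"
    and roots: "\<And>\<rho>. poly g \<rho> = 0 \<Longrightarrow> Re ((x - \<rho>) / u) > 0"
  shows "poly (gen_op \<alpha> W g) x \<noteq> 0"
proof -
  let ?c = "cross_form \<alpha> n u {#}"
  let ?A = "\<lambda>y. image_mset (\<lambda>\<rho>. y - \<rho>) (proots g)"
  have size: "size (?A y) = degree g" for y by (simp add: size_proots_complex)
  have g0: "g \<noteq> 0" using nz by (auto simp: gen_op_def inner_sum_def divided_deriv_def)
  have R: "binom_poly ?c (degree g) \<noteq> 0"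
  proof
    assume "binom_poly ?c (degree g) = 0"
    then have c0: "cross_form \<alpha> n u' {#} k = 0" if "k \<le> 0 + degree g" for k u'
      using that cross_form_empty_indep[of \<alpha> n u u'] by (simp add: binom_poly_eq_0_iff)
    have "poly (gen_op \<alpha> W g) y = 0" for y
      using poly_gen_op[OF g, of W y "csqrt (poly W y)" \<alpha>] cross_form_eq_0[of 0 "?A y" \<alpha> n "csqrt (poly W y)" 0] c0
      unfolding size by simp
    then show False using nz poly_all_0_iff_0 by blast
  qed
  then have Q0: "Q_poly \<alpha> n \<noteq> 0"
  proof -
    have "binom_poly ?c n \<noteq> 0"
      using R g unfolding binom_poly_eq_0_iff by (meson le_trans)
    then obtain z where z: "poly (binom_poly ?c n * [:0, 1:]) z \<noteq> 0"
      by (metis mult_eq_0_iff pCons_eq_0_iff poly_all_0_iff_0 zero_neq_one)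
    then show ?thesis using binom_poly_cross_form_eq_Q_poly[of z n n \<alpha> u] by auto
  qed
  have "right_nonzero (binom_poly ?c n)"
    unfolding right_nonzero_def
  proof (intro allI impI notI)
    fix z assume z: "Re z > 0" and 0: "poly (binom_poly ?c n) z = 0"
    have "poly (complexify (Q_poly \<alpha> n)) (1 / z\<^sup>2) = 0"
      using 0 z by (subst (asm) binom_poly_cross_form_eq_Q_poly) auto
    then obtain t where t: "t \<le> 0" "1 / z\<^sup>2 = of_real t"
      using zeros_in_P_plus[OF Q Q0] by blast
    have "z \<noteq> 0" using z by auto
    with t have "of_real t * z\<^sup>2 = 1" by (simp add: field_simps)
    \<comment> \<open>As \<open>Re z > 0\<close>, the second equation gives
      \<open>t * Im z = 0\<close>, and the first becomes \<open>t * (Re z)\<^sup>2 = 1\<close>,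
      impossible for \<open>t \<le> 0\<close>.\<close>
    then have "t * ((Re z)\<^sup>2 - (Im z)\<^sup>2) = 1" "t * (Re z * Im z) = 0"
      by (auto simp: complex_eq_iff Re_power2 Im_power2)
    then have "t * (Re z)\<^sup>2 = 1" using z by (auto simp: algebra_simps)
    then show False using t(1) by (metis mult_nonneg_nonpos2 not_one_le_zero zero_le_power2)
  qed
  then have "right_nonzero (binom_poly ?c (0 + size (?A x)))"
    unfolding size using right_nonzero_binom_poly_lower[OF _ g R] by simp
  then have "right_nonzero (binom_poly (cross_form \<alpha> n u (?A x)) 0)"
    using u by (rule right_nonzero_cross_form) (use roots g0 in auto)
  \<comment> \<open>For \<open>m = 0\<close> the polynomial is this constant, so any point of the
    half plane, here \<open>1\<close>, reads it off.\<close>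
  then have "cross_form \<alpha> n u (?A x) 0 \<noteq> 0"
    by (auto simp: right_nonzero_def poly_binom_poly intro: exI[of _ 1])
  then show ?thesis using poly_gen_op[OF g W] g0 by simp
qed

subsection \<open>The polynomials \<open>Q\<close> and \<open>Y\<close>\<close>

text \<open>At its own pole the polar derivative degenerates: the term with \<open>a / b - z\<close>
  drops out, and each step leaves only the factor \<open>u * v\<close>.\<close>

lemma cross_form_replicate_mset:
  assumes "u * v \<noteq> 0"
  shows "poly (binom_poly (cross_form \<alpha> M u (replicate_mset i v)) m) ((v\<^sup>2 + u\<^sup>2) / (u * v)) =
    (u * v) ^ i * poly (binom_poly (cross_form \<alpha> M u {#}) (m + i)) ((v\<^sup>2 + u\<^sup>2) / (u * v))"
proof (induction i arbitrary: m)
  case (Suc i)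
  let ?a = "v\<^sup>2 + u\<^sup>2" and ?b = "u * v" and ?c = "cross_form \<alpha> M u (replicate_mset i v)"
  have "cross_form \<alpha> M u (replicate_mset (Suc i) v) = (\<lambda>k. ?a * ?c k + ?b * ?c (Suc k))"
    by (simp add: fun_eq_iff cross_form_add_mset)
  then have "poly (binom_poly (cross_form \<alpha> M u (replicate_mset (Suc i) v)) m) (?a / ?b) =
      ?b * poly (binom_poly ?c (Suc m)) (?a / ?b)"
    using assms by (simp only: poly_binom_poly_step) (simp add: right_diff_distrib)
  with Suc[of "Suc m"] show ?case by simp
qed simp

text \<open>\<open>n\<close> factors with \<open>v = 1\<close> and \<open>u\<^sup>2 = t\<close> give
  \<open>Y\<close> at \<open>t\<close>. All poles agree with \<open>(1 + t) / u\<close>, whose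
  inverse square is \<open>t / (1 + t)\<^sup>2\<close>; the powers of \<open>u\<close>
  cancel.\<close>

lemma poly_Y_poly_eq_Q_poly:
  assumes "t \<noteq> 0" "t \<noteq> -1"
  shows "poly (complexify (Y_poly \<alpha> n)) t =
    fact n * (1 + t) ^ n * poly (complexify (Q_poly \<alpha> n)) (t / (1 + t)\<^sup>2)"
proof -
  define u where "u = csqrt t"
  have u: "u\<^sup>2 = t" "u \<noteq> 0" using assms by (auto simp: u_def)
  have t: "1 + t \<noteq> 0" using assms by (metis add.inverse_unique)
  let ?A = "replicate_mset n (1 :: complex)"
  have coeff: "coeff (\<Prod>v\<in>#?A. [:v, 1:]) i = of_nat (n choose i)" for i
  proof (cases "i \<le> n")
    case False
    then show ?thesis
      by (subst coeff_eq_0) (auto simp: degree_linear_power binomial_eq_0)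
  qed (simp add: coeff_linear_poly_power)
  have "poly (complexify (Y_poly \<alpha> n)) t = cross_form \<alpha> n u ?A 0"
    using op_value_eq_cross_form[of ?A n \<alpha> u]
    unfolding coeff by (simp add: poly_Y_poly u sum_distrib_left sum_distrib_right mult_ac)
  also have "\<dots> = u ^ n * poly (binom_poly (cross_form \<alpha> n u {#}) n) ((1 + t) / u)"
    using cross_form_replicate_mset[of u 1 \<alpha> n n 0] u by (simp add: poly_binom_poly[of _ 0])
  also have "\<dots> = fact n * (1 + t) ^ n * poly (complexify (Q_poly \<alpha> n)) (t / (1 + t)\<^sup>2)"
    using u t by (simp add: binom_poly_cross_form_eq_Q_poly power_divide)
  finally show ?thesis .
qed

lemma degree_Q_poly_le: "degree (Q_poly \<alpha> n) \<le> n"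
  unfolding Q_poly_def by (intro degree_sum_le order_trans[OF degree_monom_le]) auto

lemma degree_Y_poly_le: "degree (Y_poly \<alpha> n) \<le> n"
  unfolding Y_poly_def by (intro degree_sum_le order_trans[OF degree_monom_le]) auto

lemma in_P_plusI:
  assumes "degree p \<le> n"
    and "\<And>w. p \<noteq> 0 \<Longrightarrow> poly (complexify p) w = 0 \<Longrightarrow> \<exists>t\<le>0. w = of_real t"
  shows "p \<in> P_plus n"
proof -
  have "w \<in> of_real ` {..0}" if "p \<noteq> 0" "poly (complexify p) w = 0" for w
    using assms(2)[OF that] by auto
  then show ?thesis
    using assms(1) by (auto simp: P_plus_def zeros_in_def map_poly_eq_0_iff)
qed

lemma complexify_eq_0_iff [simp]: "complexify p = 0 \<longleftrightarrow> p = 0"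
  by (simp add: map_poly_eq_0_iff)

lemma ex_nonzero_arg:
  fixes p :: "complex poly"
  assumes "p \<noteq> 0"
  shows "\<exists>w. w \<noteq> 0 \<and> w \<noteq> -1 \<and> poly p w \<noteq> 0"
proof -
  have "p * [:0, 1:] * [:1, 1:] \<noteq> 0" using assms by (simp only: mult_eq_0_iff) simp
  then obtain w where "poly (p * [:0, 1:] * [:1, 1:]) w \<noteq> 0"
    using poly_all_0_iff_0 by blast
  then show ?thesis by (intro exI[of _ w]) auto
qed

text \<open>The two solutions have product one and real sum below \<open>-2\<close>, so they are not conjugate.\<close>
lemma koebe_fibre_nonpos:
  fixes t :: complex
  assumes t: "t = of_real w * (1 + t)\<^sup>2" and w: "w \<le> 0"
  shows "\<exists>y\<le>0. t = of_real y"
proof -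
  define p where "p = - w"
  define x where "x = Re t"
  define y where "y = Im t"
  have p: "p \<ge> 0" using w by (simp add: p_def)
  have re: "- p * ((1 + x)\<^sup>2 - y\<^sup>2) = x" and im: "- p * (2 * (1 + x) * y) = y"
    using arg_cong[OF t[symmetric], of Re] arg_cong[OF t[symmetric], of Im]
    by (simp_all add: p_def x_def y_def Re_power2 Im_power2)
  have "y = 0"
  proof (rule ccontr)
    assume "y \<noteq> 0"
    \<comment> \<open>A nonreal solution would have \<open>p * (1 + x) = - 1 / 2\<close>. Inserted
      into the real part this gives \<open>x\<^sup>2 + y\<^sup>2 = 1\<close>, hence
      \<open>1 + x \<ge> 0\<close>, a contradiction.\<close>
    have "y * (2 * p * (1 + x) + 1) = 0" using im by (simp add: algebra_simps)
    then have 1: "2 * p * (1 + x) = -1" using \<open>y \<noteq> 0\<close> by auto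
    have "2 * (1 + x) * (- p * ((1 + x)\<^sup>2 - y\<^sup>2)) = - (2 * p * (1 + x)) * ((1 + x)\<^sup>2 - y\<^sup>2)"
      by simp
    then have "2 * (1 + x) * x = (1 + x)\<^sup>2 - y\<^sup>2" unfolding re 1 by simp
    then have "x\<^sup>2 + y\<^sup>2 = 1" by (simp add: power2_eq_square algebra_simps)
    then have "x\<^sup>2 \<le> 1" using zero_le_power2[of y] by linarith
    then have "\<bar>x\<bar> \<le> 1" by (simp add: abs_square_le_1)
    then have "2 * p * (1 + x) \<ge> 0" using p by simp
    then show False using 1 by simp
  qed
  moreover have "x \<le> 0"
  proof -
    have "- p * ((1 + x)\<^sup>2 - y\<^sup>2) \<le> 0" using p \<open>y = 0\<close> by simp
    then show ?thesis unfolding re .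
  qed
  ultimately show ?thesis by (intro exI[of _ x]) (simp add: complex_eq_iff x_def y_def)
qed

text \<open>\<open>t\<close> is a root of the quadratic \<open>w * (1 + t)\<^sup>2 - t\<close>,
  which takes the values \<open>w\<close> at \<open>0\<close> and \<open>1\<close> at
  \<open>-1\<close>.\<close>

lemma koebe_surj:
  fixes w :: complex
  assumes "w \<noteq> 0"
  obtains t where "t \<noteq> 0" "t \<noteq> -1" "w = t / (1 + t)\<^sup>2"
proof -
  have "degree [:w, 2 * w - 1, w:] > 0" using assms by simp
  then obtain t where "poly [:w, 2 * w - 1, w:] t = 0"
    using alg_closed_imp_poly_has_root by blast
  then have t: "w * (1 + t)\<^sup>2 = t" by (simp add: power2_eq_square algebra_simps)
  then have "t \<noteq> -1" "t \<noteq> 0" using assms by auto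
  moreover from this have "1 + t \<noteq> 0" by (metis add.inverse_unique)
  ultimately show ?thesis using t by (intro that[of t]) (auto simp: field_simps)
qed

text \<open>The map from \<open>t\<close> to \<open>t / (1 + t)\<^sup>2\<close> carries zeros of
  \<open>Y\<close> to zeros of \<open>Q\<close>, reaches every nonzero value, and both sends
  nonpositive points to nonpositive points and pulls them back to such. The exceptional arguments
  \<open>0\<close> and \<open>-1\<close> are nonpositive themselves.\<close>

lemma Q_poly_iff_Y_poly: "Q_poly \<alpha> n \<in> P_plus n \<longleftrightarrow> Y_poly \<alpha> n \<in> P_plus n"
proof
  assume Q: "Q_poly \<alpha> n \<in> P_plus n"
  show "Y_poly \<alpha> n \<in> P_plus n"
  proof (rule in_P_plusI[OF degree_Y_poly_le])
    fix t assume Y: "Y_poly \<alpha> n \<noteq> 0" "poly (complexify (Y_poly \<alpha> n)) t = 0"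
    have Q0: "Q_poly \<alpha> n \<noteq> 0"
    proof -
      obtain w where "w \<noteq> 0" "w \<noteq> -1" "poly (complexify (Y_poly \<alpha> n)) w \<noteq> 0"
        using ex_nonzero_arg[of "complexify (Y_poly \<alpha> n)"] Y by auto
      then show ?thesis using poly_Y_poly_eq_Q_poly[of w \<alpha> n] by auto
    qed
    show "\<exists>y\<le>0. t = of_real y"
    proof (cases "t = 0 \<or> t = -1")
      case True
      then show ?thesis by (auto intro: exI[of _ 0] exI[of _ "-1"])
    next
      case False
      then have t: "1 + t \<noteq> 0" by (metis add.inverse_unique)
      with False Y have "poly (complexify (Q_poly \<alpha> n)) (t / (1 + t)\<^sup>2) = 0"
        by (simp add: poly_Y_poly_eq_Q_poly)
      then obtain w where "w \<le> 0" "t / (1 + t)\<^sup>2 = of_real w"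
        using zeros_in_P_plus[OF Q Q0] by blast
      with t show ?thesis by (intro koebe_fibre_nonpos[of t w]) (auto simp: field_simps)
    qed
  qed
next
  assume Y: "Y_poly \<alpha> n \<in> P_plus n"
  show "Q_poly \<alpha> n \<in> P_plus n"
  proof (rule in_P_plusI[OF degree_Q_poly_le])
    fix w assume Q: "Q_poly \<alpha> n \<noteq> 0" "poly (complexify (Q_poly \<alpha> n)) w = 0"
    have Y0: "Y_poly \<alpha> n \<noteq> 0"
    proof
      assume 0: "Y_poly \<alpha> n = 0"
      obtain w' where w': "w' \<noteq> 0" "poly (complexify (Q_poly \<alpha> n)) w' \<noteq> 0"
        using ex_nonzero_arg[of "complexify (Q_poly \<alpha> n)"] Q by auto
      obtain t where t: "t \<noteq> 0" "t \<noteq> -1" "w' = t / (1 + t)\<^sup>2" using koebe_surj[OF w'(1)] .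
      then have "1 + t \<noteq> 0" by (metis add.inverse_unique)
      with 0 t w' poly_Y_poly_eq_Q_poly[of t \<alpha> n] show False by simp
    qed
    show "\<exists>y\<le>0. w = of_real y"
    proof (cases "w = 0")
      case True
      then show ?thesis by (auto intro: exI[of _ 0])
    next
      case False
      then obtain t where t: "t \<noteq> 0" "t \<noteq> -1" "w = t / (1 + t)\<^sup>2" using koebe_surj by blast
      with Q have "poly (complexify (Y_poly \<alpha> n)) t = 0" by (simp add: poly_Y_poly_eq_Q_poly)
      then obtain y where y: "y \<le> 0" "t = of_real y" using zeros_in_P_plus[OF Y Y0] by blast
      then have "w = of_real (y / (1 + y)\<^sup>2)" using t by simp
      then show ?thesis using y(1) by (intro exI[of _ "y / (1 + y)\<^sup>2"]) (simp add: divide_nonpos_nonneg)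
    qed
  qed
qed

subsection \<open>Powers of linear factors as test polynomials\<close>

text \<open>The derivatives of orders \<open>k + j\<close> and \<open>k - j\<close> contribute
  powers of \<open>x - t\<close> whose exponents add up to \<open>2 * n - 2 * k\<close>,
  independently of \<open>j\<close>.\<close>

lemma poly_gen_op_linear_power:
  assumes "x \<noteq> t"
  shows "poly (gen_op \<alpha> W ([:-t, 1:] ^ n)) x =
    (x - t) ^ (2 * n) * poly (complexify (Y_poly \<alpha> n)) (poly W x / (x - t)\<^sup>2)"
proof -
  have comp: "([:-t, 1:] ^ n) \<circ>\<^sub>p [:x, 1:] = [:x - t, 1:] ^ n" for n
  proof (induction n)
    case (Suc n)
    then show ?case by (simp only: power_Suc pcompose_mult) (simp add: pcompose_pCons)
  qed (simp add: pcompose_1)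
  have dd: "poly (divided_deriv m ([:-t, 1:] ^ n)) x = of_nat (n choose m) * (x - t) ^ (n - m)" for m
  proof (cases "m \<le> n")
    case False
    then show ?thesis unfolding poly_divided_deriv comp
      by (subst coeff_eq_0) (auto simp: degree_linear_power binomial_eq_0)
  qed (simp add: poly_divided_deriv comp coeff_linear_poly_power)
  have "poly (gen_op \<alpha> W ([:-t, 1:] ^ n)) x = (\<Sum>k\<le>n. \<Sum>j\<le>k. of_real (\<alpha> j) *
     (of_nat (n choose (k + j)) * (x - t) ^ (n - (k + j)) * (of_nat (n choose (k - j)) * (x - t) ^ (n - (k - j))))
     * poly W x ^ k)"
    by (simp add: gen_op_def degree_linear_power poly_sum inner_sum_def dd sum_distrib_right mult.assoc)
  also have "\<dots> = (\<Sum>k\<le>n. \<Sum>j\<le>k. (x - t) ^ (2 * n) *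
     (of_real (\<alpha> j * real (n choose (k + j)) * real (n choose (k - j))) * (poly W x / (x - t)\<^sup>2) ^ k))"
  proof (intro sum.cong refl)
    fix k j :: nat assume kj: "j \<in> {..k}"
    have "(x - t) ^ (n - (k + j)) * (x - t) ^ (n - (k - j)) * poly W x ^ k =
        (x - t) ^ (2 * n) * (poly W x / (x - t)\<^sup>2) ^ k" if "k + j \<le> n"
    proof -
      have "n - (k + j) + (n - (k - j)) = 2 * n - 2 * k" "2 * k \<le> 2 * n" using kj that by auto
      then have "(x - t) ^ (n - (k + j)) * (x - t) ^ (n - (k - j)) = (x - t) ^ (2 * n - 2 * k)"
        by (simp only: flip: power_add)
      also have "\<dots> = (x - t) ^ (2 * n) / ((x - t)\<^sup>2) ^ k"
        using assms \<open>2 * k \<le> 2 * n\<close> by (subst power_diff) (auto simp: power_mult)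
      finally have "(x - t) ^ (n - (k + j)) * (x - t) ^ (n - (k - j)) = (x - t) ^ (2 * n) / ((x - t)\<^sup>2) ^ k" .
      then show ?thesis by (simp add: power_divide)
    qed
    \<comment> \<open>For \<open>k + j > n\<close> truncated subtraction falsifies the exponents,
      but then the binomial coefficient is zero.\<close>
    then have "of_real (\<alpha> j) * of_nat (n choose (k + j)) * of_nat (n choose (k - j)) *
        ((x - t) ^ (n - (k + j)) * (x - t) ^ (n - (k - j)) * poly W x ^ k) =
        of_real (\<alpha> j) * of_nat (n choose (k + j)) * of_nat (n choose (k - j)) *
        ((x - t) ^ (2 * n) * (poly W x / (x - t)\<^sup>2) ^ k)"
      by (cases "k + j \<le> n") (simp_all only: binomial_eq_0 not_le of_nat_0 mult_zero_right mult_zero_left)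
    then show "of_real (\<alpha> j) * (of_nat (n choose (k + j)) * (x - t) ^ (n - (k + j)) *
        (of_nat (n choose (k - j)) * (x - t) ^ (n - (k - j)))) * poly W x ^ k =
        (x - t) ^ (2 * n) * (of_real (\<alpha> j * real (n choose (k + j)) * real (n choose (k - j)))
          * (poly W x / (x - t)\<^sup>2) ^ k)"
      by (simp only: mult_ac of_real_mult of_real_of_nat_eq)
  qed
  finally show ?thesis by (simp add: poly_Y_poly sum_distrib_left sum_distrib_right)
qed

text \<open>By \<open>deg\<close>, the equation \<open>poly W x = w * (x - t)\<^sup>2\<close> is
  nonconstant and has a solution; it differs from \<open>t\<close> because \<open>W\<close> does not
  vanish there.\<close>

lemma Y_poly_zero_transfer:
  assumes zin: "zeros_in (gen_op \<alpha> W ([:-t, 1:] ^ n)) S" and Wt: "poly W t \<noteq> 0"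
    and deg: "\<And>w. w \<noteq> 0 \<Longrightarrow> degree (W - smult w ([:-t, 1:]\<^sup>2)) \<noteq> 0"
    and Y: "Y_poly \<alpha> n \<noteq> 0" and w: "poly (complexify (Y_poly \<alpha> n)) w = 0" "w \<noteq> 0"
  shows "\<exists>x\<in>S. x \<noteq> t \<and> poly W x = w * (x - t)\<^sup>2"
proof -
  have ex: "\<exists>x. x \<noteq> t \<and> poly W x = v * (x - t)\<^sup>2" if v: "v \<noteq> 0" for v
  proof -
    obtain x where "poly (W - smult v ([:-t, 1:]\<^sup>2)) x = 0"
      using alg_closed_imp_poly_has_root[of "W - smult v ([:-t, 1:]\<^sup>2)"] deg[OF v] by auto
    then have "poly W x = v * (x - t)\<^sup>2" by (simp add: algebra_simps)
    moreover from this have "x \<noteq> t" using Wt by auto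
    ultimately show ?thesis by blast
  qed
  \<comment> \<open>A nonzero value of \<open>Y\<close> is transferred first, to exclude the zero
    polynomial, about which \<open>zeros_in\<close> says nothing.\<close>
  obtain v where v: "v \<noteq> 0" "poly (complexify (Y_poly \<alpha> n)) v \<noteq> 0"
    using ex_nonzero_arg[of "complexify (Y_poly \<alpha> n)"] Y by auto
  obtain y where "y \<noteq> t" "poly W y = v * (y - t)\<^sup>2" using ex[OF v(1)] by blast
  then have "poly (gen_op \<alpha> W ([:-t, 1:] ^ n)) y \<noteq> 0"
    using v(2) by (simp add: poly_gen_op_linear_power)
  then have nz: "gen_op \<alpha> W ([:-t, 1:] ^ n) \<noteq> 0" by auto
  obtain x where x: "x \<noteq> t" "poly W x = w * (x - t)\<^sup>2" using ex[OF w(2)] by blast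
  then have "poly (gen_op \<alpha> W ([:-t, 1:] ^ n)) x = 0"
    using w(1) by (simp add: poly_gen_op_linear_power)
  then show ?thesis using zin nz x by (auto simp: zeros_in_def)
qed

lemma Y_poly_in_P_plus_if_zeros_in:
  assumes zin: "zeros_in (gen_op \<alpha> W ([:-t, 1:] ^ n)) S" and Wt: "poly W t \<noteq> 0"
    and deg: "\<And>w. w \<noteq> 0 \<Longrightarrow> degree (W - smult w ([:-t, 1:]\<^sup>2)) \<noteq> 0"
    and S: "\<And>x. x \<in> S \<Longrightarrow> x \<noteq> t \<Longrightarrow> \<exists>y\<le>0. poly W x / (x - t)\<^sup>2 = of_real y"
  shows "Y_poly \<alpha> n \<in> P_plus n"
proof (rule in_P_plusI[OF degree_Y_poly_le])
  fix w assume Y: "Y_poly \<alpha> n \<noteq> 0" "poly (complexify (Y_poly \<alpha> n)) w = 0"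
  show "\<exists>y\<le>0. w = of_real y"
  proof (cases "w = 0")
    case True
    then show ?thesis by (auto intro: exI[of _ 0])
  next
    case False
    then obtain x where "x \<in> S" "x \<noteq> t" "poly W x = w * (x - t)\<^sup>2"
      using Y_poly_zero_transfer[OF zin Wt deg] Y by blast
    with S[of x] show ?thesis by auto
  qed
qed

subsection \<open>Choosing the square root\<close>

lemma Re_of_real_mult: "Re (of_real c * z) = c * Re z"
  by simp

lemma Re_divide_pos_iff: "Re (p / q) > 0 \<longleftrightarrow> q \<noteq> 0 \<and> Re p * Re q + Im p * Im q > 0"
proof (cases "q = 0")
  case False
  then have "(Re q)\<^sup>2 + (Im q)\<^sup>2 > 0" by (simp add: complex_eq_iff sum_power2_gt_zero_iff)
  with False show ?thesis by (simp add: Re_divide zero_less_divide_iff not_less_iff_gr_or_eq)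
qed simp

text \<open>The expression is \<open>Re (p * cnj q)\<close>, so it controls both
  \<open>p / q\<close> and \<open>q / p\<close>. As \<open>p\<^sup>2 - q\<^sup>2\<close> is real,
  \<open>Re p * Im p = Re q * Im q\<close>, so the imaginary parts cannot have opposite signs if
  both real parts are positive. A vanishing real part puts \<open>x\<close> on the real line, to be
  treated separately.\<close>

lemma csqrt_ratio_pos_outside:
  assumes ab: "a < b" and x: "x \<notin> complex_of_real ` {a..b}"
  defines "p \<equiv> csqrt (x - of_real a)" and "q \<equiv> csqrt (x - of_real b)"
  shows "Re p * Re q + Im p * Im q > 0"
proof -
  have pa: "p\<^sup>2 = x - of_real a" and qb: "q\<^sup>2 = x - of_real b" by (simp_all add: p_def q_def)
  have "p\<^sup>2 - q\<^sup>2 = of_real (b - a)" unfolding pa qb by simp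
  then have re: "(Re p)\<^sup>2 - (Im p)\<^sup>2 - ((Re q)\<^sup>2 - (Im q)\<^sup>2) = b - a" and im: "Re p * Im p = Re q * Im q"
    by (auto simp: complex_eq_iff Re_power2 Im_power2)
  have p: "0 < Re p \<or> Re p = 0 \<and> 0 \<le> Im p" and q: "0 < Re q \<or> Re q = 0 \<and> 0 \<le> Im q"
    unfolding p_def q_def by (rule csqrt_principal)+
  consider "Re p > 0" "Re q > 0" | "Re p = 0" "Im p \<ge> 0" | "Re p > 0" "Re q = 0"
    using p q by auto
  then show ?thesis
  proof cases
    case 1
    have "Re q * (Im p * Im q) = Im p * (Re p * Im p)" unfolding im by simp
    also have "\<dots> = Re p * (Im p)\<^sup>2" by (simp add: power2_eq_square)
    also have "\<dots> \<ge> 0" using 1 by simp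
    finally have "Im p * Im q \<ge> 0" using 1 by (simp add: zero_le_mult_iff)
    then show ?thesis using 1 by (simp add: add_pos_nonneg)
  next
    case 2
    have "x = of_real (a - (Im p)\<^sup>2)"
      using pa 2 by (simp add: complex_eq_iff Re_power2 Im_power2)
    with x ab have "Im p \<noteq> 0" by auto
    with 2 have ip: "Im p > 0" by simp
    have "Re q * Im q = 0" using im 2 by simp
    moreover have "Im q \<noteq> 0"
    proof
      assume "Im q = 0"
      then have "- (Im p)\<^sup>2 - (Re q)\<^sup>2 = b - a" using re 2 by simp
      then show False using ab zero_le_power2[of "Im p"] zero_le_power2[of "Re q"] by linarith
    qed
    ultimately have "Im q > 0" using q by auto
    with ip 2 show ?thesis by simp
  next
    case 3
    then have "Im p = 0" using im by simp
    then have "x = of_real (a + (Re p)\<^sup>2)" "x = of_real (b - (Im q)\<^sup>2)"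
      using pa qb 3 by (simp_all add: complex_eq_iff Re_power2 Im_power2)
    then have "x \<in> complex_of_real ` {a..b}" by (metis (no_types) atLeastAtMost_iff
      diff_ge_0_iff_ge diff_le_eq image_eqI le_add_same_cancel1 of_real_eq_iff zero_le_power2)
    with x show ?thesis by simp
  qed
qed

text \<open>For \<open>u = sqrt c * p * q\<close> the quotients at the two ends are
  \<open>p / q\<close> and \<open>q / p\<close> up to a positive factor; the points between are
  convex combinations.\<close>

lemma direction_interval:
  assumes ab: "a < b" and c: "c > 0" and x: "x \<notin> complex_of_real ` {a..b}"
  shows "\<exists>u. u \<noteq> 0 \<and> u\<^sup>2 = of_real c * ((x - of_real a) * (x - of_real b)) \<and>
    (\<forall>\<rho>\<in>complex_of_real ` {a..b}. Re ((x - \<rho>) / u) > 0)"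
proof -
  define p where "p = csqrt (x - of_real a)"
  define q where "q = csqrt (x - of_real b)"
  define u where "u = of_real (sqrt c) * (p * q)"
  have p2: "p\<^sup>2 = x - of_real a" and q2: "q\<^sup>2 = x - of_real b" by (simp_all add: p_def q_def)
  have pos: "Re p * Re q + Im p * Im q > 0"
    unfolding p_def q_def by (rule csqrt_ratio_pos_outside[OF ab x])
  then have nz: "p \<noteq> 0" "q \<noteq> 0" by auto
  have "(x - of_real a) / u = p / q / of_real (sqrt c)" "(x - of_real b) / u = q / p / of_real (sqrt c)"
    unfolding u_def p2[symmetric] q2[symmetric] using nz by (simp_all add: power2_eq_square)
  moreover have "Re (p / q) > 0" "Re (q / p) > 0"
    using pos nz by (auto simp: Re_divide_pos_iff mult.commute)
  ultimately have ends: "Re ((x - of_real a) / u) > 0" "Re ((x - of_real b) / u) > 0"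
    using c by (simp_all only: Re_divide_of_real) (simp_all only: divide_pos_pos real_sqrt_gt_zero)
  have "Re ((x - of_real \<rho>) / u) > 0" if \<rho>: "a \<le> \<rho>" "\<rho> \<le> b" for \<rho>
  proof -
    have "of_real (b - a) * ((x - of_real \<rho>) / u) =
        of_real (b - \<rho>) * ((x - of_real a) / u) + of_real (\<rho> - a) * ((x - of_real b) / u)"
      by (simp add: diff_divide_distrib algebra_simps add_divide_distrib)
    then have "(b - a) * Re ((x - of_real \<rho>) / u) =
        (b - \<rho>) * Re ((x - of_real a) / u) + (\<rho> - a) * Re ((x - of_real b) / u)"
      by (metis Re_of_real_mult plus_complex.sel(1))
    also have "\<dots> > 0"
    \<comment> \<open>At \<open>\<rho> = b\<close> the first weight vanishes, and strict positivity
      comes from the second summand.\<close>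
    proof (cases "\<rho> = b")
      case False
      then show ?thesis using \<rho> ends by (intro add_pos_nonneg mult_pos_pos mult_nonneg_nonneg) auto
    qed (use ab ends in simp)
    finally show ?thesis using ab by (simp add: zero_less_mult_iff)
  qed
  moreover have "u\<^sup>2 = of_real c * ((x - of_real a) * (x - of_real b))"
    using c by (simp add: u_def power_mult_distrib p2 q2 flip: of_real_power)
  moreover have "u \<noteq> 0" using c nz by (simp add: u_def)
  ultimately show ?thesis by (intro exI[of _ u]) auto
qed

lemma csqrt_Re_pos:
  assumes "z \<notin> complex_of_real ` {..0}"
  shows "Re (csqrt z) > 0"
proof (rule ccontr)
  assume "\<not> ?thesis"
  then have "Re (csqrt z) = 0" using csqrt_principal[of z] by auto
  then have "(csqrt z)\<^sup>2 = of_real (- (Im (csqrt z))\<^sup>2)"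
    by (simp add: complex_eq_iff Re_power2 Im_power2 del: csqrt.simps power2_csqrt)
  then have "z = of_real (- (Im (csqrt z))\<^sup>2)" by simp
  moreover have "- (Im (csqrt z))\<^sup>2 \<in> {..0}" by simp
  ultimately show False using assms by blast
qed

text \<open>Here \<open>p\<^sup>2 + q\<^sup>2 = b - a\<close>, so
  \<open>Im p * Im q \<le> 0\<close>, which helps \<open>Re (p * q)\<close> but opposes the first
  claim. That one amounts to \<open>(Re p * Re q)\<^sup>2 > k\<^sup>2\<close>.\<close>

lemma csqrt_ratio_pos_inside:
  assumes ab: "a < b" and x: "x \<notin> complex_of_real ` ({..a} \<union> {b..})"
  defines "p \<equiv> csqrt (x - of_real a)" and "q \<equiv> csqrt (of_real b - x)"
  shows "Re p * Re q + Im p * Im q > 0" "Re (p * q) > 0"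
proof -
  have "x - of_real a \<notin> complex_of_real ` {..0}"
  proof
    assume "x - of_real a \<in> complex_of_real ` {..0}"
    then obtain t where "t \<le> 0" "x = of_real (a + t)" by (auto simp: algebra_simps)
    moreover from this ab have "a + t \<in> {..a} \<union> {b..}" by auto
    ultimately show False using x by blast
  qed
  moreover have "of_real b - x \<notin> complex_of_real ` {..0}"
  proof
    assume "of_real b - x \<in> complex_of_real ` {..0}"
    then obtain t where "t \<le> 0" "x = of_real (b - t)" by (auto simp: algebra_simps)
    moreover from this ab have "b - t \<in> {..a} \<union> {b..}" by auto
    ultimately show False using x by blast
  qed
  ultimately have p: "Re p > 0" and q: "Re q > 0"
    unfolding p_def q_def by (auto intro!: csqrt_Re_pos simp del: csqrt.simps)
  define k where "k = Re p * Im p"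
  have "p\<^sup>2 + q\<^sup>2 = of_real (b - a)" by (simp add: p_def q_def)
  then have re: "(Re p)\<^sup>2 - (Im p)\<^sup>2 + ((Re q)\<^sup>2 - (Im q)\<^sup>2) = b - a" and im: "Re q * Im q = - k"
    by (auto simp: complex_eq_iff Re_power2 Im_power2 k_def)
  have kk: "(Re p * Re q) * (Im p * Im q) = - k\<^sup>2"
  proof -
    have "(Re p * Re q) * (Im p * Im q) = k * (Re q * Im q)" by (simp add: k_def)
    then show ?thesis unfolding im by (simp add: power2_eq_square)
  qed
  then have "(Re p * Re q) * (Im p * Im q) \<le> 0" by simp
  then have "Im p * Im q \<le> 0" using p q by (simp add: mult_le_0_iff)
  then show "Re (p * q) > 0" using mult_pos_pos[OF p q] by simp
  \<comment> \<open>After multiplication by this positive sum, the difference becomes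
    \<open>(Re p * Re q)\<^sup>2 * (b - a)\<close>.\<close>
  have "((Re p)\<^sup>2 + (Re q)\<^sup>2) * ((Re p * Re q)\<^sup>2 - k\<^sup>2) =
      (Re p * Re q)\<^sup>2 * ((Re p)\<^sup>2 + (Re q)\<^sup>2) - (Re q)\<^sup>2 * k\<^sup>2 - (Re p)\<^sup>2 * (- k)\<^sup>2"
    by (simp add: power2_eq_square algebra_simps)
  also have "\<dots> = (Re p * Re q)\<^sup>2 * ((Re p)\<^sup>2 - (Im p)\<^sup>2 + ((Re q)\<^sup>2 - (Im q)\<^sup>2))"
    unfolding im[symmetric] by (simp add: k_def power2_eq_square algebra_simps)
  also have "\<dots> > 0" unfolding re using p q ab by simp
  finally have "(Re p * Re q)\<^sup>2 - k\<^sup>2 > 0"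
    by (rule zero_less_mult_pos) (use p q in \<open>simp add: add_pos_pos\<close>)
  also have "(Re p * Re q)\<^sup>2 - k\<^sup>2 = (Re p * Re q) * (Re p * Re q + Im p * Im q)"
    unfolding distrib_left kk by (simp add: power2_eq_square)
  finally show "Re p * Re q + Im p * Im q > 0"
    by (rule zero_less_mult_pos) (rule mult_pos_pos[OF p q])
qed

text \<open>The root \<open>u\<close> serves the left ray and \<open>- u\<close> the right one.
  Moving from an end outwards along its ray adds a nonnegative multiple of \<open>1 / u\<close>, and
  \<open>Re u > 0\<close>.\<close>

lemma direction_two_rays:
  assumes ab: "a < b" and c: "c > 0" and x: "x \<notin> complex_of_real ` ({..a} \<union> {b..})"
  shows "\<exists>u. u \<noteq> 0 \<and> u\<^sup>2 = of_real (- c) * ((x - of_real a) * (x - of_real b)) \<and>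
    (\<forall>\<rho>\<in>complex_of_real ` {..a}. Re ((x - \<rho>) / u) > 0) \<and>
    (\<forall>\<rho>\<in>complex_of_real ` {b..}. Re ((x - \<rho>) / (- u)) > 0)"
proof -
  define p where "p = csqrt (x - of_real a)"
  define q where "q = csqrt (of_real b - x)"
  define u where "u = of_real (sqrt c) * (p * q)"
  have p2: "p\<^sup>2 = x - of_real a" and q2: "q\<^sup>2 = of_real b - x" by (simp_all add: p_def q_def)
  have pos: "Re p * Re q + Im p * Im q > 0" "Re (p * q) > 0"
    unfolding p_def q_def by (rule csqrt_ratio_pos_inside[OF ab x])+
  then have nz: "p \<noteq> 0" "q \<noteq> 0" by auto
  have "(x - of_real a) / u = p / q / of_real (sqrt c)" "(of_real b - x) / u = q / p / of_real (sqrt c)"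
    unfolding u_def p2[symmetric] q2[symmetric] using nz by (simp_all add: power2_eq_square)
  moreover have "Re (p / q) > 0" "Re (q / p) > 0"
    using pos nz by (auto simp: Re_divide_pos_iff mult.commute)
  ultimately have ends: "Re ((x - of_real a) / u) > 0" "Re ((of_real b - x) / u) > 0"
    using c by (simp_all only: Re_divide_of_real) (simp_all only: divide_pos_pos real_sqrt_gt_zero)
  have "Re u > 0" unfolding u_def Re_of_real_mult using c pos by simp
  then have inv: "Re (1 / u) > 0" by (rule Re_inverse_pos)
  have "Re ((x - of_real \<rho>) / u) > 0" if "\<rho> \<le> a" for \<rho>
  proof -
    have "(x - of_real \<rho>) / u = (x - of_real a) / u + of_real (a - \<rho>) * (1 / u)"
      by (simp add: diff_divide_distrib)
    then have "Re ((x - of_real \<rho>) / u) = Re ((x - of_real a) / u) + (a - \<rho>) * Re (1 / u)"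
      by (simp only: Re_of_real_mult plus_complex.sel)
    then show ?thesis using ends inv that by (simp only: add_pos_nonneg mult_nonneg_nonneg less_imp_le diff_ge_0_iff_ge)
  qed
  moreover have "Re ((x - of_real \<rho>) / (- u)) > 0" if "b \<le> \<rho>" for \<rho>
  proof -
    have "(x - of_real \<rho>) / (- u) = (of_real b - x) / u + of_real (\<rho> - b) * (1 / u)"
      by (simp add: diff_divide_distrib)
    then have "Re ((x - of_real \<rho>) / (- u)) = Re ((of_real b - x) / u) + (\<rho> - b) * Re (1 / u)"
      by (simp only: Re_of_real_mult plus_complex.sel)
    then show ?thesis using ends inv that by (simp only: add_pos_nonneg mult_nonneg_nonneg less_imp_le diff_ge_0_iff_ge)
  qed
  moreover have "u\<^sup>2 = of_real (- c) * ((x - of_real a) * (x - of_real b))"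
    using c by (simp add: u_def power_mult_distrib p2 q2 algebra_simps flip: of_real_power)
  moreover have "u \<noteq> 0" using c nz by (simp add: u_def)
  ultimately show ?thesis by (intro exI[of _ u]) auto
qed

text \<open>For \<open>r > 0\<close> the principal root works, since
  \<open>r * (x / u) = u + s / u\<close>. Going from \<open>0\<close> to
  \<open>\<rho> \<le> 0\<close> adds a nonnegative multiple of \<open>1 / u\<close>.\<close>

lemma direction_linear:
  assumes rs: "r \<ge> 0" "s \<ge> 0" "r \<noteq> 0 \<or> s \<noteq> 0" and x: "x \<notin> \<real>"
  shows "\<exists>u. u \<noteq> 0 \<and> u\<^sup>2 = of_real r * x - of_real s \<and>
    (\<forall>\<rho>\<in>complex_of_real ` {..0}. Re ((x - \<rho>) / u) > 0)"
proof -
  have Imx: "Im x \<noteq> 0" using x by (simp add: complex_is_Real_iff)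
  have "\<exists>u. u \<noteq> 0 \<and> u\<^sup>2 = of_real r * x - of_real s \<and> Re (x / u) > 0 \<and> Re (1 / u) \<ge> 0"
  proof (cases "r = 0")
    case True
    with rs have s: "s > 0" by simp
    \<comment> \<open>The sign is chosen so that
      \<open>Re (x / u) = \<bar>Im x\<bar> / sqrt s\<close>.\<close>
    define u where "u = of_real (sgn (Im x) * sqrt s) * \<i>"
    have "u\<^sup>2 = of_real r * x - of_real s"
      using s Imx True by (simp add: u_def power_mult_distrib sgn_real_def flip: of_real_power)
    moreover have "u \<noteq> 0" using s Imx by (simp add: u_def sgn_eq_0_iff)
    moreover have "Re (x / u) > 0"
      using s Imx calculation(2)
      by (auto simp: Re_divide_pos_iff u_def sgn_real_def mult_less_0_iff)
    moreover have "Re (1 / u) \<ge> 0" by (simp add: Re_divide u_def)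
    ultimately show ?thesis by blast
  next
    case False
    with rs have r: "r > 0" by simp
    define u where "u = csqrt (of_real r * x - of_real s)"
    have u2: "u\<^sup>2 = of_real r * x - of_real s" by (simp add: u_def)
    have "of_real r * x - of_real s \<notin> complex_of_real ` {..0}"
    proof
      assume "of_real r * x - of_real s \<in> complex_of_real ` {..0}"
      then obtain t where "of_real r * x - of_real s = of_real t" by auto
      from arg_cong[OF this, of Im] show False using r Imx by simp
    qed
    then have u: "Re u > 0" unfolding u_def by (rule csqrt_Re_pos)
    then have "u \<noteq> 0" by auto
    have "of_real r * (x / u) = u + of_real s * (1 / u)"
      using \<open>u \<noteq> 0\<close> u2 by (simp add: field_simps power2_eq_square)
    then have "r * Re (x / u) = Re u + s * Re (1 / u)"
      by (metis Re_of_real_mult plus_complex.sel(1))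
    also have "\<dots> > 0" using u Re_inverse_pos[OF u] rs by (intro add_pos_nonneg mult_nonneg_nonneg) auto
    finally have "Re (x / u) > 0" using r by (simp add: zero_less_mult_iff)
    then show ?thesis using u2 \<open>u \<noteq> 0\<close> Re_inverse_pos[OF u] by (intro exI[of _ u]) auto
  qed
  then obtain u where u: "u \<noteq> 0" "u\<^sup>2 = of_real r * x - of_real s" "Re (x / u) > 0" "Re (1 / u) \<ge> 0"
    by blast
  have "Re ((x - of_real \<rho>) / u) > 0" if "\<rho> \<le> 0" for \<rho>
  proof -
    have "(x - of_real \<rho>) / u = x / u + of_real (- \<rho>) * (1 / u)"
      by (simp add: diff_divide_distrib)
    then have "Re ((x - of_real \<rho>) / u) = Re (x / u) + (- \<rho>) * Re (1 / u)"
      by (simp only: Re_of_real_mult plus_complex.sel)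
    then show ?thesis using u that by (simp only: add_pos_nonneg mult_nonneg_nonneg neg_0_le_iff_le)
  qed
  with u show ?thesis by (intro exI[of _ u]) auto
qed

subsection \<open>The equivalences\<close>

lemma U_op_eq_gen_op:
  "U_op \<alpha> a b c = gen_op \<alpha> (smult (of_real c) ([:- of_real a, 1:] * [:- of_real b, 1:]))"
  unfolding U_op_def gen_op_def fun_eq_iff smult_power of_real_power power_mult_distrib by simp

lemma poly_factored_quadratic:
  fixes x :: complex
  shows "poly (smult (of_real c) ([:- of_real a, 1:] * [:- of_real b, 1:])) x =
    of_real c * ((x - of_real a) * (x - of_real b))"
  by (simp add: algebra_simps)

lemma E_op_eq_gen_op: "E_op \<alpha> r s = gen_op \<alpha> [:- of_real s, of_real r:]"
  by (simp add: E_op_def gen_op_def fun_eq_iff)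

text \<open>Reduces each zero location to geometry: off \<open>S\<close>, some square root of the
  weight must have every \<open>x - \<rho>\<close> in its open right half plane.\<close>

lemma gen_op_zeros_in:
  assumes Q: "Q_poly \<alpha> n \<in> P_plus n" and g: "degree g \<le> n" "zeros_in g T"
    and dir: "\<And>x. x \<notin> S \<Longrightarrow> \<exists>u. u \<noteq> 0 \<and> u\<^sup>2 = poly W x \<and> (\<forall>\<rho>\<in>T. Re ((x - \<rho>) / u) > 0)"
  shows "zeros_in (gen_op \<alpha> W g) S"
proof (cases "gen_op \<alpha> W g = 0")
  case False
  then have "g \<noteq> 0" by (auto simp: gen_op_def inner_sum_def divided_deriv_def)
  with g have T: "\<rho> \<in> T" if "poly g \<rho> = 0" for \<rho> using that by (auto simp: zeros_in_def)
  have "x \<in> S" if "poly (gen_op \<alpha> W g) x = 0" for x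
  proof (rule ccontr)
    assume "x \<notin> S"
    from dir[OF this] obtain u where "u \<noteq> 0" "u\<^sup>2 = poly W x" "\<forall>\<rho>\<in>T. Re ((x - \<rho>) / u) > 0"
      by blast
    then have "poly (gen_op \<alpha> W g) x \<noteq> 0"
      using T by (intro poly_gen_op_nonzero[OF Q g(1) False, of x u]) auto
    with that show False by simp
  qed
  then show ?thesis by (simp add: zeros_in_def)
qed (simp add: zeros_in_def)

lemma zeros_in_linear_power: "t \<in> S \<Longrightarrow> zeros_in ([:- t, 1:] ^ n) S"
  by (auto simp: zeros_in_def)

lemma degree_quadratic_minus_square:
  fixes w t A B C :: complex
  assumes "A \<noteq> w \<or> B \<noteq> - 2 * w * t"
  shows "degree ([:C, B, A:] - smult w ([:-t, 1:]\<^sup>2)) \<noteq> 0"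
proof
  assume deg: "degree ([:C, B, A:] - smult w ([:-t, 1:]\<^sup>2)) = 0"
  then have "coeff ([:C, B, A:] - smult w ([:-t, 1:]\<^sup>2)) i = 0" if "i > 0" for i
    using that deg by (intro coeff_eq_0) simp
  from this[of 1] this[of 2] show False
    using assms by (simp add: power2_eq_square numeral_2_eq_2 eq_neg_iff_add_eq_0 mult_ac)
qed

text \<open>Here \<open>c\<close> may have either sign, to cover both versions of the operator. The
  midpoint is excluded as \<open>t\<close>: for \<open>w = c\<close> it is the one choice that makes
  \<open>W - w * (X - t)\<^sup>2\<close> constant.\<close>

lemma Y_poly_in_P_plus_if_U_op:
  assumes abc: "a < b" "c \<noteq> 0" and t: "t \<noteq> a" "t \<noteq> b" "2 * t \<noteq> a + b"
    and zin: "zeros_in (U_op \<alpha> a b c ([:- of_real t, 1:] ^ n)) (complex_of_real ` S)"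
    and S: "\<And>x. x \<in> S \<Longrightarrow> c * ((x - a) * (x - b)) \<le> 0"
  shows "Y_poly \<alpha> n \<in> P_plus n"
proof (rule Y_poly_in_P_plus_if_zeros_in[OF zin[unfolded U_op_eq_gen_op]])
  let ?W = "smult (of_real c) ([:- of_real a, 1:] * [:- of_real b, 1:]) :: complex poly"
  show "poly ?W (of_real t) \<noteq> 0" unfolding poly_factored_quadratic using abc t by simp
  show "degree (?W - smult w ([:- of_real t, 1:]\<^sup>2)) \<noteq> 0" if "w \<noteq> 0" for w
  proof -
    have W: "?W = [:of_real (c * a * b), of_real (- c * (a + b)), of_real c:]"
      by (simp add: algebra_simps)
    have "of_real c \<noteq> w \<or> of_real (- c * (a + b)) \<noteq> - 2 * w * of_real t"
    proof (rule ccontr)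
      assume "\<not> ?thesis"
      then have "complex_of_real (- c * (a + b)) = of_real (- 2 * c * t)" by auto
      then have "- c * (a + b) = - 2 * c * t" by (simp only: of_real_eq_iff)
      then show False using abc t by auto
    qed
    then show ?thesis unfolding W by (rule degree_quadratic_minus_square)
  qed
  fix x assume "x \<in> complex_of_real ` S"
  then obtain y where y: "y \<in> S" "x = of_real y" by auto
  have "poly ?W x / (x - of_real t)\<^sup>2 = of_real (c * ((y - a) * (y - b)) / (y - t)\<^sup>2)"
    unfolding poly_factored_quadratic using y by simp
  moreover have "c * ((y - a) * (y - b)) / (y - t)\<^sup>2 \<le> 0"
    using S[OF y(1)] by (simp add: divide_nonpos_nonneg)
  ultimately show "\<exists>y\<le>0. poly ?W x / (x - of_real t)\<^sup>2 = of_real y" by blast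
qed

text \<open>On the real line \<^term>\<open>(r * x - s) / (x + T)\<^sup>2\<close> is at most \<^term>\<open>r / (4 * T)\<close>, so a zero
  of \<^term>\<open>Y_poly \<alpha> n\<close> has to be smaller than this for every \<^term>\<open>T > 0\<close>.\<close>
lemma Y_poly_in_P_plus_if_E_op:
  assumes rs: "r \<ge> 0" "s \<ge> 0" "r \<noteq> 0 \<or> s \<noteq> 0"
    and zin: "\<And>T. T > 0 \<Longrightarrow> zeros_in (E_op \<alpha> r s ([:of_real T, 1:] ^ n)) \<real>"
  shows "Y_poly \<alpha> n \<in> P_plus n"
proof (rule in_P_plusI[OF degree_Y_poly_le])
  fix w assume Y: "Y_poly \<alpha> n \<noteq> 0" "poly (complexify (Y_poly \<alpha> n)) w = 0"
  show "\<exists>y\<le>0. w = of_real y"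
  proof (cases "w = 0")
    case True
    then show ?thesis by (auto intro: exI[of _ 0])
  next
    case w: False
    have real: "\<exists>x. x \<noteq> - T \<and> of_real (r * x - s) = w * of_real ((x + T)\<^sup>2)" if T: "T > 0" for T
    proof -
      have "\<exists>x\<in>\<real>. x \<noteq> of_real (- T) \<and> poly [:- of_real s, of_real r:] x = w * (x - of_real (- T))\<^sup>2"
      proof (rule Y_poly_zero_transfer[OF _ _ _ Y w])
        show "zeros_in (gen_op \<alpha> [:- of_real s, of_real r:] ([:- of_real (- T), 1:] ^ n)) \<real>"
          using zin[OF T] by (simp add: E_op_eq_gen_op)
        have "r * T + s > 0" using rs T
          by (metis add_pos_nonneg add_nonneg_pos less_eq_real_def mult_pos_pos mult_nonneg_nonneg)
        then have "- s - r * T \<noteq> 0" by simp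
        then have "complex_of_real (- s - r * T) \<noteq> 0" by (simp only: of_real_eq_0_iff not_False_eq_True)
        then show "poly [:- of_real s, of_real r:] (complex_of_real (- T)) \<noteq> 0" by (simp add: mult.commute)
        show "degree ([:- of_real s, of_real r:] - smult v ([:- of_real (- T), 1:]\<^sup>2)) \<noteq> 0"
          if "v \<noteq> 0" for v :: complex
          using degree_quadratic_minus_square[of 0 v "of_real r" "of_real (- T)" "- of_real s"] that by simp
      qed
      then obtain x where "x \<noteq> - T" "poly [:- of_real s, of_real r:] (complex_of_real x) = w * (of_real x - of_real (- T))\<^sup>2"
        by (auto elim!: Reals_cases)
      then show ?thesis by (intro exI[of _ x]) (simp add: mult.commute)
    qed
    obtain x where x: "x \<noteq> - 1" "of_real (r * x - s) = w * of_real ((x + 1)\<^sup>2)"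
      using real[of 1] by auto
    define y where "y = (r * x - s) / (x + 1)\<^sup>2"
    have "(x + 1)\<^sup>2 \<noteq> 0" using x by auto
    then have "complex_of_real ((x + 1)\<^sup>2) \<noteq> 0" by (simp only: of_real_eq_0_iff not_False_eq_True)
    then have wy: "w = of_real y" unfolding y_def of_real_divide x(2) by simp
    have "y \<le> 0"
    proof (rule ccontr)
      assume "\<not> y \<le> 0"
      then have y: "y > 0" by simp
      \<comment> \<open>Makes \<open>y * T = r + 1\<close> exceed \<open>r / 4\<close>, the largest
        value that the bound on the real line allows.\<close>
      define T where "T = (r + 1) / y"
      have T: "T > 0" "y * T = r + 1" using y rs by (simp_all add: T_def)
      obtain x' where x': "x' \<noteq> - T" "complex_of_real (r * x' - s) = w * of_real ((x' + T)\<^sup>2)"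
        using real[OF T(1)] by blast
      then have "complex_of_real (r * x' - s) = of_real (y * (x' + T)\<^sup>2)" by (simp add: wy)
      then have eq: "r * x' - s = y * (x' + T)\<^sup>2" by (simp only: of_real_eq_iff)
      have "y * (x' + T)\<^sup>2 > 0" using y x' by (simp add: add_eq_0_iff)
      then have "r * x' > 0" using eq rs by linarith
      then have x'0: "x' > 0" using rs by (simp add: zero_less_mult_iff)
      have "4 * x' * T \<le> (x' + T)\<^sup>2"
        using zero_le_power2[of "x' - T"] by (simp add: power2_eq_square algebra_simps)
      then have "y * (4 * x' * T) \<le> y * (x' + T)\<^sup>2" using y by simp
      moreover have "y * (4 * x' * T) = 4 * x' * (r + 1)" unfolding T(2)[symmetric] by simp
      ultimately have "4 * x' * (r + 1) \<le> r * x'" using eq rs by linarith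
      then have "x' * (3 * r + 4) \<le> 0" by (simp add: algebra_simps)
      then show False using x'0 rs by (simp add: mult_le_0_iff)
    qed
    with wy show ?thesis by blast
  qed
qed

text \<open>The weight is identically zero, so no nonzero \<open>u\<close> exists and this case
  stands apart. Only \<open>k = 0\<close> survives, through \<open>0 ^ 0 = 1\<close>.\<close>

lemma E_op_0_0: "E_op \<alpha> 0 0 g = smult (of_real (\<alpha> 0)) (g * g)"
proof -
  have "E_op \<alpha> 0 0 g = (\<Sum>k\<in>{0}. inner_sum \<alpha> k g * 0 ^ k)"
    unfolding E_op_def by (intro sum.mono_neutral_cong_right) auto
  then show ?thesis by (simp add: inner_sum_def divided_deriv_def)
qed

lemma zeros_in_E_op_0_0: "zeros_in g S \<Longrightarrow> zeros_in (E_op \<alpha> 0 0 g) S"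
  by (auto simp: E_op_0_0 zeros_in_def)

text \<open>For \<open>r = s = 0\<close> condition \<open>C6\<close> holds for every
  \<open>\<alpha>\<close>, so its converse implication assumes
  \<open>r \<noteq> 0 \<or> s \<noteq> 0\<close>. The stability claim includes that case, where the
  operator is a multiple of the square of \<open>g\<close>.\<close>

theorem theorem3p2:
  fixes n :: nat and a b c r s :: real and \<alpha> :: "nat \<Rightarrow> real"
  assumes "a < b" and "c > 0" and "r \<ge> 0" and "s \<ge> 0"
  shows
   "let C1 = (Q_poly \<alpha> n \<in> P_plus n);
        C2 = (Y_poly \<alpha> n \<in> P_plus n);
        C3 = (\<forall>g. degree g \<le> n \<and> zeros_in g (complex_of_real ` {a..b}) \<longrightarrow>
                zeros_in (U_op \<alpha> a b c g) (complex_of_real ` {a..b}));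
        C4 = (\<forall>g. degree g \<le> n \<and> zeros_in g (complex_of_real ` {..a}) \<longrightarrow>
                zeros_in (U_op \<alpha> a b (- c) g) (complex_of_real ` ({..a} \<union> {b..})));
        C5 = (\<forall>g. degree g \<le> n \<and> zeros_in g (complex_of_real ` {b..}) \<longrightarrow>
                zeros_in (U_op \<alpha> a b (- c) g) (complex_of_real ` ({..a} \<union> {b..})));
        C6 = (\<forall>g \<in> P_plus n. zeros_in (E_op \<alpha> r s (complexify g)) \<real>)
    in (C1 \<longleftrightarrow> C2) \<and> (C1 \<longleftrightarrow> C3) \<and> (C1 \<longleftrightarrow> C4) \<and> (C1 \<longleftrightarrow> C5) \<and>
       (C1 \<longrightarrow> C6) \<and> (r \<noteq> 0 \<or> s \<noteq> 0 \<longrightarrow> C6 \<longrightarrow> C1) \<and>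
       ((C1 \<or> C2 \<or> C3 \<or> C4 \<or> C5 \<or> C6) \<and> r = 0 \<longrightarrow>
          (\<forall>g. stable g \<and> degree g \<le> n \<longrightarrow> stable (E_op \<alpha> 0 s g)))"
proof -
  define C1 where "C1 = (Q_poly \<alpha> n \<in> P_plus n)"
  define C2 where "C2 = (Y_poly \<alpha> n \<in> P_plus n)"
  define C3 where "C3 = (\<forall>g. degree g \<le> n \<and> zeros_in g (complex_of_real ` {a..b}) \<longrightarrow>
                zeros_in (U_op \<alpha> a b c g) (complex_of_real ` {a..b}))"
  define C4 where "C4 = (\<forall>g. degree g \<le> n \<and> zeros_in g (complex_of_real ` {..a}) \<longrightarrow>
                zeros_in (U_op \<alpha> a b (- c) g) (complex_of_real ` ({..a} \<union> {b..})))"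
  define C5 where "C5 = (\<forall>g. degree g \<le> n \<and> zeros_in g (complex_of_real ` {b..}) \<longrightarrow>
                zeros_in (U_op \<alpha> a b (- c) g) (complex_of_real ` ({..a} \<union> {b..})))"
  define C6 where "C6 = (\<forall>g \<in> P_plus n. zeros_in (E_op \<alpha> r s (complexify g)) \<real>)"
  have 12: "C1 \<longleftrightarrow> C2" unfolding C1_def C2_def by (rule Q_poly_iff_Y_poly)
  have 13: "C1 \<longrightarrow> C3"
    unfolding C1_def C3_def U_op_eq_gen_op
  proof (intro impI allI, elim conjE, rule gen_op_zeros_in[where n = n])
    fix x assume "x \<notin> complex_of_real ` {a..b}"
    from direction_interval[OF assms(1,2) this]
    show "\<exists>u. u \<noteq> 0 \<and> u\<^sup>2 = poly (smult (of_real c) ([:- of_real a, 1:] * [:- of_real b, 1:])) x \<and>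
        (\<forall>\<rho>\<in>complex_of_real ` {a..b}. Re ((x - \<rho>) / u) > 0)"
      unfolding poly_factored_quadratic .
  qed
  have 14: "C1 \<longrightarrow> C4"
    unfolding C1_def C4_def U_op_eq_gen_op
  proof (intro impI allI, elim conjE, rule gen_op_zeros_in[where n = n])
    fix x assume "x \<notin> complex_of_real ` ({..a} \<union> {b..})"
    from direction_two_rays[OF assms(1,2) this]
    show "\<exists>u. u \<noteq> 0 \<and> u\<^sup>2 = poly (smult (of_real (- c)) ([:- of_real a, 1:] * [:- of_real b, 1:])) x \<and>
        (\<forall>\<rho>\<in>complex_of_real ` {..a}. Re ((x - \<rho>) / u) > 0)"
      unfolding poly_factored_quadratic by blast
  qed
  have 15: "C1 \<longrightarrow> C5"
    unfolding C1_def C5_def U_op_eq_gen_op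
  proof (intro impI allI, elim conjE, rule gen_op_zeros_in[where n = n])
    fix x assume "x \<notin> complex_of_real ` ({..a} \<union> {b..})"
    from direction_two_rays[OF assms(1,2) this]
    obtain u where "u \<noteq> 0" "u\<^sup>2 = of_real (- c) * ((x - of_real a) * (x - of_real b))"
      "\<forall>\<rho>\<in>complex_of_real ` {b..}. Re ((x - \<rho>) / (- u)) > 0" by blast
    then show "\<exists>u. u \<noteq> 0 \<and> u\<^sup>2 = poly (smult (of_real (- c)) ([:- of_real a, 1:] * [:- of_real b, 1:])) x \<and>
        (\<forall>\<rho>\<in>complex_of_real ` {b..}. Re ((x - \<rho>) / u) > 0)"
      unfolding poly_factored_quadratic by (intro exI[of _ "- u"]) simp
  qed
  have 16: "C1 \<longrightarrow> C6"
    unfolding C1_def C6_def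
  proof (intro impI ballI)
    fix g assume Q: "Q_poly \<alpha> n \<in> P_plus n" and g: "g \<in> P_plus n"
    have deg: "degree (complexify g) \<le> n" and zin: "zeros_in (complexify g) (complex_of_real ` {..0})"
      using g by (auto simp: P_plus_def degree_map_poly)
    show "zeros_in (E_op \<alpha> r s (complexify g)) \<real>"
    proof (cases "r = 0 \<and> s = 0")
      case True
      have "zeros_in (complexify g) \<real>" using zin by (auto simp: zeros_in_def)
      then show ?thesis using True by (auto intro: zeros_in_E_op_0_0)
    next
      case False
      show ?thesis unfolding E_op_eq_gen_op
      proof (rule gen_op_zeros_in[OF Q deg zin])
        fix x :: complex assume "x \<notin> \<real>"
        from direction_linear[OF assms(3,4) _ this] False
        show "\<exists>u. u \<noteq> 0 \<and> u\<^sup>2 = poly [:- of_real s, of_real r:] x \<and>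
            (\<forall>\<rho>\<in>complex_of_real ` {..0}. Re ((x - \<rho>) / u) > 0)"
          by (auto simp: algebra_simps)
      qed
    qed
  qed
  have 32: "C3 \<longrightarrow> C2"
    unfolding C3_def C2_def
  proof
    assume C3: "\<forall>g. degree g \<le> n \<and> zeros_in g (complex_of_real ` {a..b}) \<longrightarrow>
                zeros_in (U_op \<alpha> a b c g) (complex_of_real ` {a..b})"
    \<comment> \<open>A point inside the interval that is not its midpoint.\<close>
    define t where "t = a + (b - a) / 3"
    have t: "a < t" "2 * t < a + b" using assms(1) by (simp_all add: t_def field_simps)
    show "Y_poly \<alpha> n \<in> P_plus n"
    proof (rule Y_poly_in_P_plus_if_U_op[where t = t])
      have "zeros_in ([:- of_real t, 1:] ^ n) (complex_of_real ` {a..b})"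
        using t assms(1) by (intro zeros_in_linear_power) auto
      then show "zeros_in (U_op \<alpha> a b c ([:- of_real t, 1:] ^ n)) (complex_of_real ` {a..b})"
        using C3 by (simp add: degree_linear_power)
      show "c * ((x - a) * (x - b)) \<le> 0" if "x \<in> {a..b}" for x
        using that assms(2) by (intro mult_nonneg_nonpos) (auto simp: mult_nonneg_nonpos)
    qed (use assms t in auto)
  qed
  have outside: "- c * ((x - a) * (x - b)) \<le> 0" if "x \<in> {..a} \<union> {b..}" for x
  proof -
    have "(x - a) * (x - b) \<ge> 0" using that assms(1) by (auto simp: zero_le_mult_iff)
    then show ?thesis using assms(2) by simp
  qed
  have 42: "C4 \<longrightarrow> C2"
    unfolding C4_def C2_def
  proof
    assume C4: "\<forall>g. degree g \<le> n \<and> zeros_in g (complex_of_real ` {..a}) \<longrightarrow>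
                zeros_in (U_op \<alpha> a b (- c) g) (complex_of_real ` ({..a} \<union> {b..}))"
    show "Y_poly \<alpha> n \<in> P_plus n"
    proof (rule Y_poly_in_P_plus_if_U_op[where t = "a - 1", OF _ _ _ _ _ _ outside])
      have "zeros_in ([:- of_real (a - 1), 1:] ^ n) (complex_of_real ` {..a})"
        by (intro zeros_in_linear_power imageI) simp
      then show "zeros_in (U_op \<alpha> a b (- c) ([:- of_real (a - 1), 1:] ^ n)) (complex_of_real ` ({..a} \<union> {b..}))"
        using C4 by (simp add: degree_linear_power del: of_real_diff of_real_add)
    qed (use assms in auto)
  qed
  have 52: "C5 \<longrightarrow> C2"
    unfolding C5_def C2_def
  proof
    assume C5: "\<forall>g. degree g \<le> n \<and> zeros_in g (complex_of_real ` {b..}) \<longrightarrow>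
                zeros_in (U_op \<alpha> a b (- c) g) (complex_of_real ` ({..a} \<union> {b..}))"
    show "Y_poly \<alpha> n \<in> P_plus n"
    proof (rule Y_poly_in_P_plus_if_U_op[where t = "b + 1", OF _ _ _ _ _ _ outside])
      have "zeros_in ([:- of_real (b + 1), 1:] ^ n) (complex_of_real ` {b..})"
        by (intro zeros_in_linear_power imageI) simp
      then show "zeros_in (U_op \<alpha> a b (- c) ([:- of_real (b + 1), 1:] ^ n)) (complex_of_real ` ({..a} \<union> {b..}))"
        using C5 by (simp add: degree_linear_power del: of_real_diff of_real_add)
    qed (use assms in auto)
  qed
  have 62: "r \<noteq> 0 \<or> s \<noteq> 0 \<longrightarrow> C6 \<longrightarrow> C2"
    unfolding C6_def C2_def
  proof (intro impI)
    assume rs: "r \<noteq> 0 \<or> s \<noteq> 0" and C6: "\<forall>g \<in> P_plus n. zeros_in (E_op \<alpha> r s (complexify g)) \<real>"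
    show "Y_poly \<alpha> n \<in> P_plus n"
    proof (rule Y_poly_in_P_plus_if_E_op[OF assms(3,4) rs])
      fix T :: real assume T: "T > 0"
      have c: "complexify ([:T, 1:] ^ n) = [:of_real T, 1:] ^ n" for n
      proof (induction n)
        case (Suc n)
        then show ?case
          by (simp add: poly_eq_iff coeff_map_poly coeff_pCons split: nat.split flip: Suc)
      qed simp
      have "zeros_in ([:- of_real (- T), 1:] ^ n) (complex_of_real ` {..0})"
        using T by (intro zeros_in_linear_power) auto
      then have "[:T, 1:] ^ n \<in> P_plus n"
        unfolding P_plus_def by (simp add: c degree_linear_power)
      with C6 show "zeros_in (E_op \<alpha> r s ([:of_real T, 1:] ^ n)) \<real>" by (metis c)
    qed
  qed
  have st: "stable (E_op \<alpha> 0 s g)"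
    if any: "C1 \<or> C2 \<or> C3 \<or> C4 \<or> C5 \<or> C6" and r: "r = 0" and g: "stable g" "degree g \<le> n" for g
  proof (cases "s = 0")
    case True
    then show ?thesis using g zeros_in_E_op_0_0 by (auto simp: stable_def)
  next
    case False
    then have s: "s > 0" using assms(4) by simp
    have "C1" using any 12 32 42 52 62 False by auto
    then have Q: "Q_poly \<alpha> n \<in> P_plus n" by (simp add: C1_def)
    show ?thesis unfolding stable_def E_op_eq_gen_op
    proof (rule gen_op_zeros_in[OF Q g(2) g(1)[unfolded stable_def]])
      fix x assume x: "x \<notin> {z. Im z \<le> 0}"
      \<comment> \<open>This one root suits the whole upper half plane:
        \<open>Re ((x - \<rho>) / u)\<close> is \<open>Im (x - \<rho>) / sqrt s\<close>.\<close>
      define u where "u = of_real (sqrt s) * \<i>"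
      have "u \<noteq> 0" using s by (simp add: u_def)
      moreover have "u\<^sup>2 = poly [:- of_real s, of_real 0:] x"
        using s by (simp add: u_def power_mult_distrib flip: of_real_power)
      moreover have "Re ((x - \<rho>) / u) > 0" if "Im \<rho> \<le> 0" for \<rho>
        unfolding Re_divide_pos_iff using s x that \<open>u \<noteq> 0\<close> by (simp add: u_def)
      ultimately show "\<exists>u. u \<noteq> 0 \<and> u\<^sup>2 = poly [:- of_real s, of_real 0:] x \<and>
          (\<forall>\<rho>\<in>{z. Im z \<le> 0}. Re ((x - \<rho>) / u) > 0)" by blast
    qed
  qed
  show ?thesis
    unfolding Let_def C1_def[symmetric] C2_def[symmetric] C3_def[symmetric] C4_def[symmetric]
      C5_def[symmetric] C6_def[symmetric]
    using 12 13 14 15 16 32 42 52 62 st by blast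
qed

end
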